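(* Let $U$ and $B$ be $C^\infty$, fix $s\ge1$ and $q_0,p_0\in\mathbb{R}^m$, and let $(q(t),p(t))$ be the exact solution of $\dot q=p$, $\dot p=B(q)p-\nabla U(q)$, $q(0)=q_0$, $p(0)=p_0$. Suppose that for all sufficiently small $h>0$ there are polynomials $u=u_h$, $v=v_h$ of degree at most $s$ satisfying, for all $c\in[0,1]$, $$u(ch)=q_0+h\sum_{i=0}^{s-1}\Big(\int_0^cP_i(x)\,\mathrm{d}x\Big)\gamma_i(v),\qquad v(ch)=p_0+h\sum_{i=0}^{s-1}\Big(\int_0^cP_i(x)\,\mathrm{d}x\Big)\Big[-\eta_i(u)+\sum_{j=0}^{s-1}\rho_{ij}(u)\gamma_j(v)\Big],$$ with $(c,h)\mapsto u_h(ch), v_h(ch)$ smooth. Set $q_1=u(h)$, $p_1=v(h)$. Then, as $h\to0^+$, $$q_1=q(h)+O(h^{2s+1}),\qquad p_1=p(h)+O(h^{2s+1}),$$ i.e. the procedure has order $2s$.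
   Context: $U:\mathbb{R}^m\to\mathbb{R}$, $B:\mathbb{R}^m\to\mathbb{R}^{m\times m}$ with $B(q)^\top=-B(q)$ for all $q$. $\{P_j\}_{j\ge0}$ is the orthonormal Legendre basis on $[0,1]$ ($\deg P_j=j$, $\int_0^1P_iP_j=\delta_{ij}$), and for a path $\sigma:[0,h]\to\mathbb{R}^m$: $\gamma_j(\sigma)=\int_0^1P_j(\tau)\sigma(\tau h)\mathrm{d}\tau$, $\eta_j(\sigma)=\int_0^1P_j(\tau)\nabla U(\sigma(\tau h))\mathrm{d}\tau$, $\rho_{ij}(\sigma)=\int_0^1P_i(\tau)P_j(\tau)B(\sigma(\tau h))\mathrm{d}\tau$.
   Formalization: The maps (c,h) ↦ u_h(ch), v_h(ch) are assumed smooth up to and including h=0 (on a neighbourhood of [0,1]×[0,h_0]), not only for h>0; otherwise spurious solutions of the scheme that blow up as h→0+ make the claim false. *)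

theory Defs
  imports "HOL-Analysis.Analysis" "HOL-Library.Landau_Symbols"
begin

fun ideriv :: "'a::real_normed_vector list \<Rightarrow> ('a \<Rightarrow> 'b::real_normed_vector) \<Rightarrow> 'a \<Rightarrow> 'b" where
  "ideriv [] f = f"
| "ideriv (v # vs) f = (\<lambda>x. frechet_derivative (ideriv vs f) (at x) v)"

text \<open>C-infinity on an open set S (finite-dimensional domain): all iterated
  derivatives exist (are Frechet differentiable) at every point of S.\<close>
definition smooth_on :: "'a::real_normed_vector set \<Rightarrow> ('a \<Rightarrow> 'b::real_normed_vector) \<Rightarrow> bool" where
  "smooth_on S f \<longleftrightarrow> open S \<and> (\<forall>vs. \<forall>x\<in>S. ideriv vs f differentiable (at x))"

definition grad :: "(real^'m \<Rightarrow> real) \<Rightarrow> real^'m \<Rightarrow> real^'m" where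
  "grad U q = (\<chi> i. frechet_derivative U (at q) (axis i 1))"

text \<open>Orthonormal shifted Legendre polynomials on [0,1]:
  P_j(x) = sqrt(2j+1) * sum_k (-1)^(j+k) C(j,k) C(j+k,k) x^k.\<close>
definition Leg :: "nat \<Rightarrow> real \<Rightarrow> real" where
  "Leg j x = sqrt (2 * real j + 1) *
     (\<Sum>k\<le>j. (-1) ^ (j + k) * real (j choose k) * real ((j + k) choose k) * x ^ k)"

definition gam :: "real \<Rightarrow> nat \<Rightarrow> (real \<Rightarrow> real^'m) \<Rightarrow> real^'m" where
  "gam h j \<sigma> = integral {0..1} (\<lambda>\<tau>. Leg j \<tau> *\<^sub>R \<sigma> (\<tau> * h))"

definition eta :: "(real^'m \<Rightarrow> real) \<Rightarrow> real \<Rightarrow> nat \<Rightarrow> (real \<Rightarrow> real^'m) \<Rightarrow> real^'m" where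
  "eta U h j \<sigma> = integral {0..1} (\<lambda>\<tau>. Leg j \<tau> *\<^sub>R grad U (\<sigma> (\<tau> * h)))"

definition rho :: "(real^'m \<Rightarrow> real^'m^'m) \<Rightarrow> real \<Rightarrow> nat \<Rightarrow> nat \<Rightarrow> (real \<Rightarrow> real^'m) \<Rightarrow> real^'m^'m" where
  "rho B h i j \<sigma> = integral {0..1} (\<lambda>\<tau>. (Leg i \<tau> * Leg j \<tau>) *\<^sub>R B (\<sigma> (\<tau> * h)))"

definition vpoly_deg_le :: "nat \<Rightarrow> (real \<Rightarrow> real^'m) \<Rightarrow> bool" where
  "vpoly_deg_le s w \<longleftrightarrow> (\<exists>a::nat \<Rightarrow> real^'m. \<forall>t. w t = (\<Sum>k\<le>s. t ^ k *\<^sub>R a k))"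

end

theory Submission
  imports Defs "HOL-Computational_Algebra.Polynomial"
begin

text \<open>In the variable \<open>c = t / h\<close> the scheme reads \<open>u' = h \<Pi> v\<close> and
  \<open>v' = h \<Pi> (B(u) \<Pi> v - \<nabla>U(u))\<close>, where \<open>\<Pi>\<close> is the \<open>L\<^sup>2\<close> projection onto polynomials of degree
  below \<open>s\<close>. By bootstrapping, every smooth function of \<open>(u, v)\<close> is a polynomial of degree below \<open>s\<close> in
  \<open>t\<close> with bounded coefficients up to \<open>O(h ^ s)\<close>. Hence the residuals \<open>\<Pi> F - F\<close> are \<open>O(h ^ s)\<close>, and
  integrated against a smooth weight they even give \<open>O(h ^ (2 * s))\<close>, by orthogonality. The error \<open>e\<close>
  solves \<open>e' = h (M e + r)\<close> with \<open>M\<close> the Jacobian along the scheme and \<open>r\<close> made of such residuals and of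
  quadratic terms, so \<open>e = O(h ^ s)\<close>. Instead of Alekseev and Groebner's formula, which needs the
  derivative of the flow, repeated integration by parts of \<open>\<integral> M e\<close> moves \<open>s\<close> powers of \<open>h\<close> onto the
  weight and leaves only integrals of \<open>r\<close> against smooth weights; so \<open>e(1) = O(h ^ (2 * s + 1))\<close>.\<close>

section \<open>Orthonormality of the shifted Legendre polynomials\<close>

text \<open>Linearising along the scheme, not along the exact solution, matters: the Jacobian ends
  up inside weights, so it must be \<open>expandable\<close>, and bootstrapping supplies this for
  \<open>X\<close> and \<open>Y\<close>, while the exact solution enters only through boundedness
  and its integral equation. Each bootstrapping round gains one order because the velocity is
  \<open>h\<close> times an integral; the rounds stop at \<open>s\<close> because the projection
  reproduces only polynomials of degree below \<open>s\<close>. The size of the residuals alone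
  would yield just order \<open>s + 1\<close> for the error. Hence two properties are carried along:
  size \<open>h ^ s\<close>, and the doubled order against weights (\<open>hidden\<close>). The
  quadratic terms have order \<open>2 * s\<close> only once the error is known to be of order
  \<open>s\<close>, so the a priori bound has to precede the linearisation. The last power of
  \<open>h\<close> is the factor in front of the integral equation. As \<open>Leg\<close> is given
  by explicit coefficients, orthonormality is derived from its moments, which are alternating
  binomial sums evaluated by partial fractions.\<close>

text \<open>Pascal's rule and an index shift. These sums are, up to sign, finite differences of
  \<open>f\<close> at 0, and the recursion lowers the order by differencing \<open>f\<close>
  once.\<close>

lemma alternating_binomial_sum_Suc:
  fixes f :: "nat \<Rightarrow> real"
  shows "(\<Sum>k\<le>Suc n. (-1) ^ k * real (Suc n choose k) * f k) =
    (\<Sum>k\<le>n. (-1) ^ k * real (n choose k) * (f k - f (Suc k)))"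
proof -
  have "(\<Sum>k\<le>Suc n. (-1) ^ k * real (Suc n choose k) * f k) =
      f 0 + (\<Sum>k\<le>n. (-1) ^ Suc k * real (Suc n choose Suc k) * f (Suc k))"
    by (subst sum.atMost_Suc_shift) simp
  also have "\<dots> = f 0 + (\<Sum>k\<le>n. (-1) ^ Suc k * real (n choose Suc k) * f (Suc k))
      - (\<Sum>k\<le>n. (-1) ^ k * real (n choose k) * f (Suc k))"
    by (simp add: sum.distrib[symmetric] sum_subtractf[symmetric] algebra_simps)
  also have "f 0 + (\<Sum>k\<le>n. (-1) ^ Suc k * real (n choose Suc k) * f (Suc k)) =
      (\<Sum>k\<le>Suc n. (-1) ^ k * real (n choose k) * f k)"
    using sum.atMost_Suc_shift[of "\<lambda>k. (-1) ^ k * real (n choose k) * f k" n] by simp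
  also have "\<dots> = (\<Sum>k\<le>n. (-1) ^ k * real (n choose k) * f k)"
    by simp
  finally show ?thesis
    by (simp add: sum_subtractf[symmetric] algebra_simps)
qed

text \<open>The shift preserves the leading coefficient, so the top terms cancel. For constants the
  difference is 0, whose degree is not smaller.\<close>

lemma degree_diff_shift:
  fixes p :: "real poly"
  assumes "degree p > 0"
  shows "degree (p - pcompose p [:1, 1:]) < degree p"
proof -
  let ?q = "pcompose p [:1, 1:]"
  have "degree ?q = degree p" by (simp add: degree_pcompose)
  moreover have "coeff ?q (degree p) = lead_coeff p"
    using lead_coeff_comp[of "[:1, 1 :: real:]" p] \<open>degree ?q = degree p\<close> by simp
  ultimately have "degree (p - ?q) \<le> degree p" "coeff (p - ?q) (degree p) = 0"
    by (auto intro: degree_diff_le)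
  then show ?thesis
    using assms by (metis le_neq_implies_less degree_0 leading_coeff_0_iff)
qed

text \<open>Each differencing lowers the degree. The disjunct \<open>p = 0\<close> serves
  \<open>n = 0\<close>, where a fully differenced polynomial arrives.\<close>

lemma alternating_binomial_sum_poly_eq_0:
  fixes p :: "real poly"
  assumes "p = 0 \<or> degree p < n"
  shows "(\<Sum>k\<le>n. (-1) ^ k * real (n choose k) * poly p (real k)) = 0"
  using assms
proof (induction n arbitrary: p)
  case (Suc n)
  let ?d = "p - pcompose p [:1, 1:]"
  have "?d = 0 \<or> degree ?d < n"
  proof (cases "degree p = 0")
    case True
    then obtain a where "p = [:a:]" by (rule degree_eq_zeroE)
    then show ?thesis by simp
  next
    case False
    then show ?thesis using degree_diff_shift[of p] Suc.prems by auto
  qed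
  from Suc.IH[OF this] show ?case
    by (simp add: alternating_binomial_sum_Suc poly_pcompose add.commute del: sum.atMost_Suc)
qed auto

text \<open>Partial fractions of \<open>n! / (x (x + 1) ... (x + n))\<close>. The recursion
  subtracts the same sum at \<open>x + 1\<close>, hence the induction over arbitrary
  \<open>x\<close>.\<close>

lemma alternating_binomial_sum_inverse:
  fixes x :: real
  assumes "x > 0"
  shows "(\<Sum>k\<le>n. (-1) ^ k * real (n choose k) / (real k + x)) = fact n / pochhammer x (Suc n)"
  using assms
proof (induction n arbitrary: x)
  case (Suc n)
  have p: "pochhammer x (Suc (Suc n)) = x * pochhammer (x + 1) n * (x + 1 + n)"
    "pochhammer x (Suc n) = x * pochhammer (x + 1) n"
    "pochhammer (x + 1) (Suc n) = pochhammer (x + 1) n * (x + 1 + n)"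
    by (simp_all only: pochhammer_rec[of x] pochhammer_Suc[of "x + 1"] mult.assoc)
  have pos: "pochhammer (x + 1) n > 0" using Suc.prems by (intro pochhammer_pos) simp
  have "(\<Sum>k\<le>Suc n. (-1) ^ k * real (Suc n choose k) / (real k + x)) =
      (\<Sum>k\<le>n. (-1) ^ k * real (n choose k) / (real k + x)) -
      (\<Sum>k\<le>n. (-1) ^ k * real (n choose k) / (real k + (x + 1)))"
    using alternating_binomial_sum_Suc[of n "\<lambda>k. 1 / (real k + x)"]
    by (simp add: sum_subtractf[symmetric] algebra_simps del: sum.atMost_Suc)
  also have "\<dots> = fact n / pochhammer x (Suc n) - fact n / pochhammer (x + 1) (Suc n)"
    using Suc.prems by (simp add: Suc.IH del: pochhammer_Suc)
  also have "\<dots> = fact (Suc n) / pochhammer x (Suc (Suc n))"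
    unfolding p using pos Suc.prems by (simp add: divide_simps) (simp add: algebra_simps)?
  finally show ?case .
qed (simp add: pochhammer_1)

text \<open>Division by \<open>k + x\<close> leaves a quotient of degree below \<open>n\<close>,
  whose alternating sum vanishes, and the constant remainder \<open>p (-x)\<close>, to which partial
  fractions apply.\<close>

lemma alternating_binomial_sum_poly_divide:
  fixes p :: "real poly" and x :: real
  assumes "degree p \<le> n" "x > 0"
  shows "(\<Sum>k\<le>n. (-1) ^ k * real (n choose k) * (poly p (real k) / (real k + x))) =
    poly p (- x) * fact n / pochhammer x (Suc n)"
proof -
  let ?r = "synthetic_div p (- x)"
  have "poly p (real k) / (real k + x) = poly ?r (real k) + poly p (- x) / (real k + x)" for k
  proof -
    have "poly p (real k) = (real k + x) * poly ?r (real k) + poly p (- x)"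
      using arg_cong[OF synthetic_div_correct'[of "- x" p], of "\<lambda>q. poly q (real k)"]
      by (simp add: algebra_simps)
    moreover have "real k + x > 0" using assms(2) by simp
    ultimately show ?thesis by (simp add: field_simps)
  qed
  then have "(\<Sum>k\<le>n. (-1) ^ k * real (n choose k) * (poly p (real k) / (real k + x))) =
    (\<Sum>k\<le>n. (-1) ^ k * real (n choose k) * poly ?r (real k)) +
    poly p (- x) * (\<Sum>k\<le>n. (-1) ^ k * real (n choose k) / (real k + x))"
    by (simp add: sum.distrib[symmetric] sum_distrib_left algebra_simps)
  moreover have "?r = 0 \<or> degree ?r < n"
    using assms(1) by (auto simp: synthetic_div_eq_0_iff degree_synthetic_div)
  ultimately show ?thesis
    using assms(2) by (simp add: alternating_binomial_sum_poly_eq_0 alternating_binomial_sum_inverse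
        del: pochhammer_Suc)
qed

lemma continuous_on_Leg [continuous_intros]:
  "continuous_on A f \<Longrightarrow> continuous_on A (\<lambda>x. Leg j (f x))"
  unfolding Leg_def by (intro continuous_intros)

lemma fact_add_eq_pochhammer: "(fact (m + n) :: real) = fact m * pochhammer (real m + 1) n"
  by (simp add: pochhammer_fact pochhammer_product' add.commute)

lemma has_integral_power_interval:
  fixes c :: real
  assumes "c \<ge> 0"
  shows "((\<lambda>x::real. x ^ n) has_integral c ^ Suc n / (real n + 1)) {0..c}"
proof -
  have "((\<lambda>x::real. x ^ n) has_integral c ^ Suc n / (real n + 1) - 0 ^ Suc n / (real n + 1)) {0..c}"
  proof (rule fundamental_theorem_of_calculus)
    fix x :: real
    have "((\<lambda>x. x ^ Suc n / (real n + 1)) has_real_derivative (real n + 1) * x ^ n / (real n + 1)) (at x within {0..c})"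
      by (intro DERIV_cdivide) (use DERIV_pow[of "Suc n" x] in \<open>simp add: add.commute\<close>)
    then show "((\<lambda>x. x ^ Suc n / (real n + 1)) has_vector_derivative x ^ n) (at x within {0..c})"
      unfolding has_real_derivative_iff_has_vector_derivative
      by (simp add: add_nonneg_eq_0_iff)
  qed (use assms in simp)
  then show ?thesis by simp
qed

text \<open>The binomial \<open>(j + k) choose k\<close> is a polynomial of degree \<open>j\<close>
  in \<open>k\<close>, and integrating \<open>x ^ (k + m)\<close> produces the pole
  \<open>1 / (k + m + 1)\<close>. The factor \<open>pochhammer (- real m) j\<close> carries the
  orthogonality: it is 0 for \<open>m < j\<close>.\<close>

lemma integral_Leg_power:
  "integral {0..1} (\<lambda>x. Leg j x * x ^ m) =
    sqrt (2 * real j + 1) * (- 1) ^ j * pochhammer (- real m) j / pochhammer (real m + 1) (Suc j)"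
proof -
  \<comment> \<open>As a function of \<open>k\<close> this is \<open>(k + 1) ... (k + j)\<close>,
    that is, \<open>j!\<close> times the binomial in \<open>Leg\<close>.\<close>
  define p :: "real poly" where "p = (\<Prod>i<j. [:real i + 1, 1:])"
  have poly_p: "poly p x = pochhammer (x + 1) j" for x
    by (simp add: p_def poly_prod pochhammer_prod lessThan_atLeast0 algebra_simps)
  have "degree p = j"
    unfolding p_def by (subst degree_prod_eq_sum_degree) auto
  have binom: "real ((j + k) choose k) = poly p (real k) / fact j" for k
  proof -
    have "real ((j + k) choose k) = fact (j + k) / (fact k * fact j)"
      by (subst binomial_fact) auto
    moreover have "(fact (j + k) :: real) = fact k * pochhammer (real k + 1) j"
      by (simp add: add.commute[of j] fact_add_eq_pochhammer)
    ultimately show ?thesis by (simp add: poly_p)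
  qed
  have "((\<lambda>x. Leg j x * x ^ m) has_integral sqrt (2 * real j + 1) *
      (\<Sum>k\<le>j. (-1) ^ (j + k) * real (j choose k) * real ((j + k) choose k) * (1 / (real (k + m) + 1)))) {0..1}"
    unfolding Leg_def mult.assoc sum_distrib_right
    by (intro has_integral_mult_right has_integral_sum finite_atMost)
      (use has_integral_power_interval[of 1 "_ + m"] in
        \<open>auto simp: power_add[symmetric] intro!: has_integral_mult_right\<close>)
  then have "integral {0..1} (\<lambda>x. Leg j x * x ^ m) = sqrt (2 * real j + 1) *
      (\<Sum>k\<le>j. (-1) ^ (j + k) * real (j choose k) * real ((j + k) choose k) * (1 / (real (k + m) + 1)))"
    by (rule integral_unique)
  also have "\<dots> = sqrt (2 * real j + 1) * (-1) ^ j / fact j *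
      (\<Sum>k\<le>j. (-1) ^ k * real (j choose k) * (poly p (real k) / (real k + (real m + 1))))"
    unfolding sum_distrib_left
    by (intro sum.cong refl) (simp only: binom, simp add: power_add add_ac)
  also have "\<dots> = sqrt (2 * real j + 1) * (- 1) ^ j * poly p (- (real m + 1)) / pochhammer (real m + 1) (Suc j)"
    by (subst alternating_binomial_sum_poly_divide) (simp_all add: \<open>degree p = j\<close> del: pochhammer_Suc)
  finally show ?thesis by (simp add: poly_p del: pochhammer_Suc)
qed

lemma integral_Leg_power_eq_0: "m < j \<Longrightarrow> integral {0..1} (\<lambda>x. Leg j x * x ^ m) = 0"
  by (simp add: integral_Leg_power pochhammer_of_nat_eq_0_lemma)

lemma integrable_Leg_mult:
  "continuous_on {0..1} g \<Longrightarrow> (\<lambda>x. Leg j x * g x) integrable_on {0..1}"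
  by (intro integrable_continuous_interval continuous_intros)

lemma integral_Leg_mult_Leg_expand:
  "integral {0..1} (\<lambda>x. Leg i x * Leg j x) = sqrt (2 * real i + 1) *
     (\<Sum>k\<le>i. (-1) ^ (i + k) * real (i choose k) * real ((i + k) choose k)
       * integral {0..1} (\<lambda>x. Leg j x * x ^ k))"
proof -
  have "integral {0..1} (\<lambda>x. Leg i x * Leg j x) = integral {0..1} (\<lambda>x. sqrt (2 * real i + 1) *
     (\<Sum>k\<le>i. (-1) ^ (i + k) * real (i choose k) * real ((i + k) choose k) * (Leg j x * x ^ k)))"
    by (intro integral_cong) (simp add: Leg_def[of i] sum_distrib_left algebra_simps)
  then show ?thesis
    by (simp add: integral_sum integrable_Leg_mult continuous_intros integrable_on_mult_right)
qed

text \<open>Expand the polynomial of smaller index into powers: the moments of \<open>Leg j\<close>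
  below degree \<open>j\<close> vanish. On the diagonal only the top power survives, and the
  normalising square roots make its contribution 1.\<close>

lemma integral_Leg_mult_Leg:
  "integral {0..1} (\<lambda>x. Leg i x * Leg j x) = (if i = j then 1 else 0)"
proof (induction i j rule: linorder_wlog)
  case (le i j)
  show ?case
  proof (cases "i = j")
    case False
    with le show ?thesis
      by (simp add: integral_Leg_mult_Leg_expand integral_Leg_power_eq_0)
  next
    case True
    have sq: "(-1::real) ^ (j + j) = 1" "(-1::real) ^ j * (-1) ^ j = 1"
      by (simp_all flip: power_add mult_2)
    have "pochhammer (- real j) j = (-1) ^ j * fact j"
      by (simp add: pochhammer_same)
    moreover have "fact j * pochhammer (real j + 1) (Suc j) = (2 * real j + 1) * fact (2 * j)"
    proof -
      have "fact j * pochhammer (real j + 1) (Suc j) = (fact (j + Suc j) :: real)"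
        by (rule fact_add_eq_pochhammer[symmetric])
      also have "j + Suc j = Suc (2 * j)" by simp
      finally show ?thesis by (simp add: algebra_simps del: pochhammer_Suc)
    qed
    then have "pochhammer (real j + 1) (Suc j) = (2 * real j + 1) * fact (2 * j) / fact j"
      by (simp add: field_simps del: pochhammer_Suc)
    moreover have "real ((j + j) choose j) = fact (2 * j) / (fact j * fact j)"
      by (simp add: binomial_fact mult_2)
    moreover have "integral {0..1} (\<lambda>x. Leg j x * Leg j x) =
        sqrt (2 * real j + 1) * (real ((j + j) choose j) * integral {0..1} (\<lambda>x. Leg j x * x ^ j))"
      unfolding integral_Leg_mult_Leg_expand
      by (simp only: lessThan_Suc_atMost[symmetric] sum.lessThan_Suc sq)
        (simp add: integral_Leg_power_eq_0)
    ultimately have "integral {0..1} (\<lambda>x. Leg j x * Leg j x) =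
        (sqrt (2 * real j + 1) * sqrt (2 * real j + 1)) * ((- 1) ^ j * (- 1) ^ j) *
        (fact (2 * j) / (fact j * fact j) * fact j / ((2 * real j + 1) * fact (2 * j) / fact j))"
      by (simp only: integral_Leg_power) (simp only: times_divide_eq_right mult_ac)
    also have "\<dots> = 1"
      by (simp add: sq divide_simps add_nonneg_eq_0_iff)
    finally show ?thesis using True by simp
  qed
qed (simp add: mult.commute eq_commute)

text \<open>The leading coefficient of \<open>Leg n\<close> is nonzero, so the triangular change of
  basis can be inverted by strong induction.\<close>

lemma power_in_span_Leg: "\<exists>b. \<forall>x. x ^ n = (\<Sum>j\<le>n. b j * Leg j x)"
proof (induction n rule: less_induct)
  case (less n)
  define l where "l = sqrt (2 * real n + 1) * real ((n + n) choose n)"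
  define a where "a k = sqrt (2 * real n + 1) * ((-1) ^ (n + k) * real (n choose k) * real ((n + k) choose k))" for k
  have "l \<noteq> 0" by (simp add: l_def add_nonneg_eq_0_iff)
  have Leg_n: "Leg n x = l * x ^ n + (\<Sum>k<n. a k * x ^ k)" for x
    by (simp add: Leg_def lessThan_Suc_atMost[symmetric] l_def a_def sum_distrib_left algebra_simps
        flip: mult_2)
  obtain b where b: "\<And>k x. k < n \<Longrightarrow> x ^ k = (\<Sum>j\<le>k. b k j * Leg j x)"
    using less.IH by metis
  \<comment> \<open>The coefficients result from solving \<open>Leg_n\<close> for
    \<open>x ^ n\<close> after expanding the lower powers by induction; the inner \<open>if\<close>
    pads the expansion of \<open>x ^ k\<close> to a range independent of \<open>k\<close>.\<close>
  have "x ^ n = (\<Sum>j\<le>n. (if j = n then 1 / l else - (\<Sum>k<n. if j \<le> k then a k * b k j else 0) / l) * Leg j x)" for x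
  proof -
    have "(\<Sum>k<n. a k * x ^ k) = (\<Sum>k<n. \<Sum>j<n. (if j \<le> k then a k * b k j else 0) * Leg j x)"
    proof (rule sum.cong[OF refl])
      fix k assume "k \<in> {..<n}"
      then have "{..<n} \<inter> {j. j \<le> k} = {..k}" by auto
      then have "(\<Sum>j<n. if j \<le> k then a k * b k j * Leg j x else 0) = (\<Sum>j\<le>k. a k * b k j * Leg j x)"
        by (simp add: sum.If_cases)
      then show "a k * x ^ k = (\<Sum>j<n. (if j \<le> k then a k * b k j else 0) * Leg j x)"
        using b[of k x] \<open>k \<in> {..<n}\<close>
        by (simp add: sum_distrib_left if_distrib[of "\<lambda>y. y * _"] mult.assoc cong: if_cong)
    qed
    also have "\<dots> = (\<Sum>j<n. (\<Sum>k<n. if j \<le> k then a k * b k j else 0) * Leg j x)"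
      by (subst sum.swap) (simp add: sum_distrib_right)
    finally have "l * x ^ n = Leg n x - (\<Sum>j<n. (\<Sum>k<n. if j \<le> k then a k * b k j else 0) * Leg j x)"
      using Leg_n[of x] by simp
    then have "x ^ n = Leg n x / l - (\<Sum>j<n. (\<Sum>k<n. if j \<le> k then a k * b k j else 0) * Leg j x) / l"
      using \<open>l \<noteq> 0\<close> by (simp add: field_simps)
    also have "(\<Sum>j<n. (\<Sum>k<n. if j \<le> k then a k * b k j else 0) * Leg j x) / l =
        (\<Sum>j<n. ((\<Sum>k<n. if j \<le> k then a k * b k j else 0) / l) * Leg j x)"
      by (simp add: sum_divide_distrib[of "\<lambda>j. _ j * Leg j x"])
    finally show ?thesis
      by (simp add: lessThan_Suc_atMost[symmetric] sum_negf)
  qed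
  then show ?case
    by (intro exI[of _ "\<lambda>j. if j = n then 1 / l else - (\<Sum>k<n. if j \<le> k then a k * b k j else 0) / l"]) simp
qed

section \<open>Families of functions depending on the step size\<close>

text \<open>Here \<open>c\<close> is time rescaled to \<open>[0, 1]\<close>, so that all step sizes
  share one interval. Continuity is included so that integrals of such families exist and split
  without extra hypotheses.\<close>

definition bnd :: "nat \<Rightarrow> (real \<Rightarrow> real \<Rightarrow> real) \<Rightarrow> bool" where
  "bnd k g \<longleftrightarrow> (\<exists>C. \<forall>\<^sub>F h in at_right 0.
    continuous_on {0..1} (g h) \<and> (\<forall>c\<in>{0..1}. \<bar>g h c\<bar> \<le> C * h ^ k))"

lemma eventually_at_right_0_small: "e > 0 \<Longrightarrow> \<forall>\<^sub>F h in at_right (0::real). 0 < h \<and> h < e"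
  using eventually_at_right by blast

lemma bndI:
  assumes "\<forall>\<^sub>F h in at_right 0. continuous_on {0..1} (g h)"
    and "\<forall>\<^sub>F h in at_right 0. \<forall>c\<in>{0..1}. \<bar>g h c\<bar> \<le> C * h ^ k"
  shows "bnd k g"
  unfolding bnd_def using assms by (auto intro!: exI[of _ C] intro: eventually_conj)

lemma bndE:
  assumes "bnd k g"
  obtains C where "C > 0" "\<forall>\<^sub>F h in at_right 0. 0 < h \<and> h < 1 \<and>
    continuous_on {0..1} (g h) \<and> (\<forall>c\<in>{0..1}. \<bar>g h c\<bar> \<le> C * h ^ k)"
proof -
  from assms obtain C where C: "\<forall>\<^sub>F h in at_right 0.
      continuous_on {0..1} (g h) \<and> (\<forall>c\<in>{0..1}. \<bar>g h c\<bar> \<le> C * h ^ k)"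
    unfolding bnd_def by blast
  have "\<forall>\<^sub>F h in at_right 0. 0 < h \<and> h < 1 \<and>
    continuous_on {0..1} (g h) \<and> (\<forall>c\<in>{0..1}. \<bar>g h c\<bar> \<le> (\<bar>C\<bar> + 1) * h ^ k)"
    using C eventually_at_right_0_small[OF zero_less_one]
  proof eventually_elim
    case (elim h)
    then have "C * h ^ k \<le> (\<bar>C\<bar> + 1) * h ^ k"
      by (intro mult_right_mono) auto
    with elim show ?case by (auto intro: order_trans)
  qed
  with that[of "\<bar>C\<bar> + 1"] show thesis by simp
qed

lemma bnd_continuous: "bnd k g \<Longrightarrow> \<forall>\<^sub>F h in at_right 0. continuous_on {0..1} (g h)"
  unfolding bnd_def by (auto elim: eventually_mono)

lemma bnd_cong:
  assumes "bnd k f" "\<forall>\<^sub>F h in at_right 0. \<forall>c\<in>{0..1}. g h c = f h c"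
  shows "bnd k g"
proof -
  from assms(1) obtain C where C: "\<forall>\<^sub>F h in at_right 0.
      continuous_on {0..1} (f h) \<and> (\<forall>c\<in>{0..1}. \<bar>f h c\<bar> \<le> C * h ^ k)"
    unfolding bnd_def by blast
  have "\<forall>\<^sub>F h in at_right 0.
      continuous_on {0..1} (g h) \<and> (\<forall>c\<in>{0..1}. \<bar>g h c\<bar> \<le> C * h ^ k)"
    using C assms(2)
  proof eventually_elim
    case (elim h)
    then show ?case using continuous_on_cong[of "{0..1}" "{0..1}" "g h" "f h"] by auto
  qed
  then show ?thesis unfolding bnd_def by blast
qed

lemma bnd_dominated:
  assumes "bnd k f" "\<forall>\<^sub>F h in at_right 0. continuous_on {0..1} (g h)"
    and "\<forall>\<^sub>F h in at_right 0. \<forall>c\<in>{0..1}. \<bar>g h c\<bar> \<le> \<bar>f h c\<bar>"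
  shows "bnd k g"
proof -
  from assms(1) obtain C where C: "\<forall>\<^sub>F h in at_right 0. 0 < h \<and> h < 1 \<and>
      continuous_on {0..1} (f h) \<and> (\<forall>c\<in>{0..1}. \<bar>f h c\<bar> \<le> C * h ^ k)"
    by (rule bndE)
  have "\<forall>\<^sub>F h in at_right 0. \<forall>c\<in>{0..1}. \<bar>g h c\<bar> \<le> C * h ^ k"
    using C assms(3) by eventually_elim (auto intro: order_trans)
  with assms(2) show ?thesis by (rule bndI)
qed

lemma bnd_add:
  assumes "bnd k f" "bnd k g"
  shows "bnd k (\<lambda>h c. f h c + g h c)"
proof -
  obtain C where C: "\<forall>\<^sub>F h in at_right 0. 0 < h \<and> h < 1 \<and>
      continuous_on {0..1} (f h) \<and> (\<forall>c\<in>{0..1}. \<bar>f h c\<bar> \<le> C * h ^ k)"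
    using assms(1) by (rule bndE)
  obtain D where D: "\<forall>\<^sub>F h in at_right 0. 0 < h \<and> h < 1 \<and>
      continuous_on {0..1} (g h) \<and> (\<forall>c\<in>{0..1}. \<bar>g h c\<bar> \<le> D * h ^ k)"
    using assms(2) by (rule bndE)
  show ?thesis
  proof (rule bndI[where C = "C + D"])
    show "\<forall>\<^sub>F h in at_right 0. continuous_on {0..1} (\<lambda>c. f h c + g h c)"
      using C D by eventually_elim (auto intro: continuous_intros)
    show "\<forall>\<^sub>F h in at_right 0. \<forall>c\<in>{0..1}. \<bar>f h c + g h c\<bar> \<le> (C + D) * h ^ k"
      using C D
    proof eventually_elim
      case (elim h)
      show ?case
      proof
        fix c :: real assume "c \<in> {0..1}"
        with elim have "\<bar>f h c\<bar> \<le> C * h ^ k" "\<bar>g h c\<bar> \<le> D * h ^ k" by auto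
        then show "\<bar>f h c + g h c\<bar> \<le> (C + D) * h ^ k" by (simp add: distrib_right)
      qed
    qed
  qed
qed

lemma bnd_mult:
  assumes "bnd j f" "bnd k g"
  shows "bnd (j + k) (\<lambda>h c. f h c * g h c)"
proof -
  obtain C where C: "C > 0" "\<forall>\<^sub>F h in at_right 0. 0 < h \<and> h < 1 \<and>
      continuous_on {0..1} (f h) \<and> (\<forall>c\<in>{0..1}. \<bar>f h c\<bar> \<le> C * h ^ j)"
    using assms(1) by (rule bndE)
  obtain D where D: "\<forall>\<^sub>F h in at_right 0. 0 < h \<and> h < 1 \<and>
      continuous_on {0..1} (g h) \<and> (\<forall>c\<in>{0..1}. \<bar>g h c\<bar> \<le> D * h ^ k)"
    using assms(2) by (rule bndE)
  show ?thesis
  proof (rule bndI[where C = "C * D"])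
    show "\<forall>\<^sub>F h in at_right 0. continuous_on {0..1} (\<lambda>c. f h c * g h c)"
      using C(2) D by eventually_elim (auto intro: continuous_intros)
    show "\<forall>\<^sub>F h in at_right 0. \<forall>c\<in>{0..1}. \<bar>f h c * g h c\<bar> \<le> C * D * h ^ (j + k)"
      using C(2) D
    proof eventually_elim
      case (elim h)
      show ?case
      proof
        fix c :: real assume "c \<in> {0..1}"
        then have "\<bar>f h c\<bar> * \<bar>g h c\<bar> \<le> (C * h ^ j) * (D * h ^ k)"
          using elim C(1) by (intro mult_mono) auto
        then show "\<bar>f h c * g h c\<bar> \<le> C * D * h ^ (j + k)"
          by (simp add: abs_mult power_add mult_ac)
      qed
    qed
  qed
qed

lemma bnd_mono:
  assumes "bnd k g" "j \<le> k"
  shows "bnd j g"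
proof -
  from assms(1) obtain C where C: "C > 0" "\<forall>\<^sub>F h in at_right 0. 0 < h \<and> h < 1 \<and>
      continuous_on {0..1} (g h) \<and> (\<forall>c\<in>{0..1}. \<bar>g h c\<bar> \<le> C * h ^ k)"
    by (rule bndE)
  show ?thesis
  proof (rule bndI[where C = C])
    show "\<forall>\<^sub>F h in at_right 0. continuous_on {0..1} (g h)"
      using C(2) by eventually_elim auto
    show "\<forall>\<^sub>F h in at_right 0. \<forall>c\<in>{0..1}. \<bar>g h c\<bar> \<le> C * h ^ j"
      using C(2)
    proof eventually_elim
      case (elim h)
      then have "C * h ^ k \<le> C * h ^ j"
        using C(1) assms(2) by (intro mult_left_mono power_decreasing) auto
      with elim show ?case by (auto intro: order_trans)
    qed
  qed
qed

lemma bnd_fixed: "continuous_on {0..1} f \<Longrightarrow> bnd 0 (\<lambda>h. f)"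
proof -
  assume f: "continuous_on {0..1} f"
  then have "compact (f ` {0..1})" by (rule compact_continuous_image) simp
  then obtain C where "\<forall>c\<in>{0..1}. \<bar>f c\<bar> \<le> C"
    using compact_imp_bounded[of "f ` {0..1}"] by (auto simp: bounded_iff)
  with f show ?thesis by (intro bndI[where C = C]) auto
qed

lemma bnd_const [simp]: "bnd 0 (\<lambda>h c. a)"
  by (rule bnd_fixed) simp

lemma bnd_zero [simp]: "bnd k (\<lambda>h c. 0)"
  by (rule bndI[where C = 0]) auto

lemma bnd_step_power: "bnd k (\<lambda>h c. h ^ k)"
  by (rule bndI[where C = 1])
    (auto intro: eventually_mono[OF eventually_at_right_0_small[OF zero_less_one]])

lemma bnd_mult_left: "bnd 0 f \<Longrightarrow> bnd k g \<Longrightarrow> bnd k (\<lambda>h c. f h c * g h c)"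
  using bnd_mult[of 0 f k g] by simp

lemma bnd_mult_right: "bnd k f \<Longrightarrow> bnd 0 g \<Longrightarrow> bnd k (\<lambda>h c. f h c * g h c)"
  using bnd_mult[of k f 0 g] by simp

lemma bnd_step_mult: "bnd k g \<Longrightarrow> bnd (Suc k) (\<lambda>h c. h * g h c)"
  using bnd_mult[OF bnd_step_power[of 1], of k g] by simp

lemma bnd_uminus: "bnd k g \<Longrightarrow> bnd k (\<lambda>h c. - g h c)"
  using bnd_mult_left[OF bnd_const[of "-1"], of k g] by simp

lemma bnd_diff: "bnd k f \<Longrightarrow> bnd k g \<Longrightarrow> bnd k (\<lambda>h c. f h c - g h c)"
  using bnd_add[of k f "\<lambda>h c. - g h c"] bnd_uminus by simp

lemma bnd_sum: "(\<And>i. i \<in> I \<Longrightarrow> bnd k (g i)) \<Longrightarrow> bnd k (\<lambda>h c. \<Sum>i\<in>I. g i h c)"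
  by (induction I rule: infinite_finite_induct) (auto intro: bnd_add)

lemma bnd_integral:
  assumes "bnd k g"
  shows "bnd k (\<lambda>h c. integral {0..c} (g h))"
proof -
  from assms(1) obtain C where C: "C > 0" "\<forall>\<^sub>F h in at_right 0. 0 < h \<and> h < 1 \<and>
      continuous_on {0..1} (g h) \<and> (\<forall>c\<in>{0..1}. \<bar>g h c\<bar> \<le> C * h ^ k)"
    by (rule bndE)
  show ?thesis
  proof (rule bndI[where C = C])
    show "\<forall>\<^sub>F h in at_right 0. continuous_on {0..1} (\<lambda>c. integral {0..c} (g h))"
      using C(2) by eventually_elim
        (auto intro: indefinite_integral_continuous_1 integrable_continuous_interval)
    show "\<forall>\<^sub>F h in at_right 0. \<forall>c\<in>{0..1}. \<bar>integral {0..c} (g h)\<bar> \<le> C * h ^ k"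
      using C(2)
    proof eventually_elim
      case (elim h)
      show ?case
      proof
        fix c :: real assume c: "c \<in> {0..1}"
        have "norm (integral {0..c} (g h)) \<le> C * h ^ k * (c - 0)"
          using elim c
          by (intro integral_bound) (auto intro: continuous_on_subset)
        also have "\<dots> \<le> C * h ^ k * 1"
          using c elim C(1) by (intro mult_left_mono) auto
        finally show "\<bar>integral {0..c} (g h)\<bar> \<le> C * h ^ k" by simp
      qed
    qed
  qed
qed

text \<open>Quantities depending on \<open>h\<close> alone, such as endpoint values and full
  integrals, are treated as families constant in \<open>c\<close>, so that one calculus serves
  both.\<close>

lemma bnd_freeze:
  assumes "bnd k g" "a \<in> {0..1}"
  shows "bnd k (\<lambda>h c. g h a)"
proof -
  from assms(1) obtain C where C: "C > 0" "\<forall>\<^sub>F h in at_right 0. 0 < h \<and> h < 1 \<and>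
      continuous_on {0..1} (g h) \<and> (\<forall>c\<in>{0..1}. \<bar>g h c\<bar> \<le> C * h ^ k)"
    by (rule bndE)
  show ?thesis
    by (rule bndI[where C = C], simp) (use C(2) assms(2) in \<open>auto elim: eventually_mono\<close>)
qed

lemma bnd_integral_unit: "bnd k g \<Longrightarrow> bnd k (\<lambda>h c. integral {0..1} (g h))"
  by (rule bnd_freeze[OF bnd_integral]) auto

lemma bnd_monomial: "bnd 0 (\<lambda>h c. a h) \<Longrightarrow> bnd i (\<lambda>h c. a h * (h * c) ^ i)"
  using bnd_mult_right[OF bnd_mult_left[OF _ bnd_step_power[of i]] bnd_fixed[of "\<lambda>c. c ^ i"], of "\<lambda>h c. a h"]
  by (simp add: power_mult_distrib mult.assoc continuous_intros)

text \<open>Stands in for a Taylor expansion in the time \<open>t = h * c\<close>; no derivatives of \<open>g\<close> are needed.\<close>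

definition expandable :: "nat \<Rightarrow> (real \<Rightarrow> real \<Rightarrow> real) \<Rightarrow> bool" where
  "expandable k g \<longleftrightarrow> (\<exists>a. (\<forall>i<k. bnd 0 (\<lambda>h c. a i h)) \<and>
     bnd k (\<lambda>h c. g h c - (\<Sum>i<k. a i h * (h * c) ^ i)))"

lemma expandable_0 [simp]: "expandable 0 g \<longleftrightarrow> bnd 0 g"
  by (simp add: expandable_def)

lemma expandable_bnd: "bnd k g \<Longrightarrow> expandable k g"
  unfolding expandable_def by (intro exI[of _ "\<lambda>i h. 0"]) simp

lemma expandable_cong:
  assumes "expandable k f" "\<forall>\<^sub>F h in at_right 0. \<forall>c\<in>{0..1}. g h c = f h c"
  shows "expandable k g"
proof -
  from assms(1) obtain a where a: "\<And>i. i < k \<Longrightarrow> bnd 0 (\<lambda>h c. a i h)"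
    "bnd k (\<lambda>h c. f h c - (\<Sum>i<k. a i h * (h * c) ^ i))" unfolding expandable_def by blast
  have "bnd k (\<lambda>h c. g h c - (\<Sum>i<k. a i h * (h * c) ^ i))"
    by (rule bnd_cong[OF a(2)]) (use assms(2) in \<open>auto elim: eventually_mono\<close>)
  with a(1) show ?thesis unfolding expandable_def by blast
qed

lemma expandable_add:
  assumes "expandable k f" "expandable k g"
  shows "expandable k (\<lambda>h c. f h c + g h c)"
proof -
  obtain a where a: "\<And>i. i < k \<Longrightarrow> bnd 0 (\<lambda>h c. a i h)"
    "bnd k (\<lambda>h c. f h c - (\<Sum>i<k. a i h * (h * c) ^ i))"
    using assms(1) unfolding expandable_def by blast
  obtain b where b: "\<And>i. i < k \<Longrightarrow> bnd 0 (\<lambda>h c. b i h)"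
    "bnd k (\<lambda>h c. g h c - (\<Sum>i<k. b i h * (h * c) ^ i))"
    using assms(2) unfolding expandable_def by blast
  have "bnd k (\<lambda>h c. f h c + g h c - (\<Sum>i<k. (a i h + b i h) * (h * c) ^ i))"
    using bnd_add[OF a(2) b(2)] by (simp add: sum.distrib algebra_simps)
  then show ?thesis unfolding expandable_def
    by (intro exI[of _ "\<lambda>i h. a i h + b i h"]) (auto intro: bnd_add a b)
qed

text \<open>Degrees from \<open>k\<close> on go into the remainder, since \<open>(h * c) ^ i\<close>
  is then of order \<open>k\<close>. Thus products and longer expansions need no truncation by
  hand.\<close>

lemma expandable_monomial:
  assumes "bnd 0 (\<lambda>h c. a h)"
  shows "expandable k (\<lambda>h c. a h * (h * c) ^ i)"
proof (cases "i < k")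
  case True
  have "(\<Sum>j<k. (if j = i then a h else 0) * (h * c) ^ j) = a h * (h * c) ^ i" for h c
    using True by (simp add: if_distrib[of "\<lambda>y. y * _"] cong: if_cong)
  moreover have coeff: "bnd 0 (\<lambda>h c. if j = i then a h else 0)" for j
    using assms by (cases "j = i") simp_all
  ultimately show ?thesis unfolding expandable_def
    by (intro exI[of _ "\<lambda>j h. if j = i then a h else 0"])
      (use coeff in auto)
next
  case False
  then show ?thesis
    by (intro expandable_bnd bnd_mono[OF bnd_monomial[OF assms]]) simp
qed

lemma expandable_step_const: "bnd 0 (\<lambda>h c. a h) \<Longrightarrow> expandable k (\<lambda>h c. a h)"
  using expandable_monomial[of a k 0] by simp

lemma expandable_const [simp]: "expandable k (\<lambda>h c. a)"
  by (rule expandable_step_const) simp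

lemma expandable_sum:
  "(\<And>i. i \<in> I \<Longrightarrow> expandable k (g i)) \<Longrightarrow> expandable k (\<lambda>h c. \<Sum>i\<in>I. g i h c)"
  by (induction I rule: infinite_finite_induct) (auto intro: expandable_add)

lemma bnd_polynomial:
  "(\<And>i. i < k \<Longrightarrow> bnd 0 (\<lambda>h c. a i h)) \<Longrightarrow> bnd 0 (\<lambda>h c. \<Sum>i<k. a i h * (h * c) ^ i)"
  by (intro bnd_sum bnd_mono[OF bnd_monomial]) auto

lemma expandable_imp_bnd:
  assumes "expandable k g"
  shows "bnd 0 g"
proof -
  from assms obtain a where a: "\<And>i. i < k \<Longrightarrow> bnd 0 (\<lambda>h c. a i h)"
    "bnd k (\<lambda>h c. g h c - (\<Sum>i<k. a i h * (h * c) ^ i))" unfolding expandable_def by blast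
  show ?thesis
    using bnd_add[OF bnd_mono[OF a(2), of 0] bnd_polynomial[of k a, OF a(1)]] by simp
qed

lemma expandable_mult:
  assumes "expandable k f" "expandable k g"
  shows "expandable k (\<lambda>h c. f h c * g h c)"
proof -
  obtain a where a: "\<And>i. i < k \<Longrightarrow> bnd 0 (\<lambda>h c. a i h)"
    "bnd k (\<lambda>h c. f h c - (\<Sum>i<k. a i h * (h * c) ^ i))"
    using assms(1) unfolding expandable_def by blast
  obtain b where b: "\<And>i. i < k \<Longrightarrow> bnd 0 (\<lambda>h c. b i h)"
    "bnd k (\<lambda>h c. g h c - (\<Sum>i<k. b i h * (h * c) ^ i))"
    using assms(2) unfolding expandable_def by blast
  have "expandable k (\<lambda>h c. \<Sum>i<k. \<Sum>j<k. (a i h * b j h) * (h * c) ^ (i + j))"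
    by (intro expandable_sum expandable_monomial bnd_mult_left) (auto intro: a b)
  \<comment> \<open>With polynomial parts \<open>P\<close> and \<open>Q\<close>:
    \<open>f g = P Q + (f - P) g + P (g - Q)\<close>, and the last two terms are of order
    \<open>k\<close>.\<close>
  moreover have "expandable k (\<lambda>h c. (f h c - (\<Sum>i<k. a i h * (h * c) ^ i)) * g h c
      + (\<Sum>i<k. a i h * (h * c) ^ i) * (g h c - (\<Sum>i<k. b i h * (h * c) ^ i)))"
    by (intro expandable_bnd bnd_add bnd_mult_left bnd_mult_right a b bnd_polynomial
        expandable_imp_bnd[OF assms(2)])
  ultimately have "expandable k (\<lambda>h c. (\<Sum>i<k. \<Sum>j<k. (a i h * b j h) * (h * c) ^ (i + j)) +
      ((f h c - (\<Sum>i<k. a i h * (h * c) ^ i)) * g h c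
      + (\<Sum>i<k. a i h * (h * c) ^ i) * (g h c - (\<Sum>i<k. b i h * (h * c) ^ i))))"
    by (rule expandable_add)
  moreover have "(\<Sum>i<k. \<Sum>j<k. (a i h * b j h) * (h * c) ^ (i + j)) =
      (\<Sum>i<k. a i h * (h * c) ^ i) * (\<Sum>i<k. b i h * (h * c) ^ i)" for h c
    unfolding sum_product by (intro sum.cong refl) (simp only: power_add mult_ac)
  ultimately show ?thesis by (simp add: algebra_simps)
qed

lemma expandable_uminus: "expandable k g \<Longrightarrow> expandable k (\<lambda>h c. - g h c)"
  using expandable_mult[OF expandable_const[of k "-1"], of g] by simp

lemma expandable_diff:
  "expandable k f \<Longrightarrow> expandable k g \<Longrightarrow> expandable k (\<lambda>h c. f h c - g h c)"
  using expandable_add[of k f "\<lambda>h c. - g h c"] expandable_uminus by simp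

lemma expandable_mono:
  assumes "expandable k g" "j \<le> k"
  shows "expandable j g"
proof -
  from assms(1) obtain a where a: "\<And>i. i < k \<Longrightarrow> bnd 0 (\<lambda>h c. a i h)"
    "bnd k (\<lambda>h c. g h c - (\<Sum>i<k. a i h * (h * c) ^ i))" unfolding expandable_def by blast
  have "expandable j (\<lambda>h c. (g h c - (\<Sum>i<k. a i h * (h * c) ^ i)) + (\<Sum>i<k. a i h * (h * c) ^ i))"
    by (intro expandable_add expandable_bnd bnd_mono[OF a(2)] expandable_sum expandable_monomial a assms)
      (auto intro: a)
  then show ?thesis by simp
qed

lemma integral_add_continuous:
  fixes f g :: "real \<Rightarrow> real"
  assumes "continuous_on {0..1} f" "continuous_on {0..1} g" "c \<in> {0..1}"
  shows "integral {0..c} (\<lambda>x. f x + g x) = integral {0..c} f + integral {0..c} g"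
  using assms by (intro integral_add integrable_continuous_interval) (auto intro: continuous_on_subset)

lemma integral_diff_continuous:
  fixes u v :: "real \<Rightarrow> real"
  assumes "continuous_on {0..1} u" "continuous_on {0..1} v" "c \<in> {0..1}"
  shows "integral {0..c} (\<lambda>x. u x - v x) = integral {0..c} u - integral {0..c} v"
  using assms by (intro integral_diff integrable_continuous_interval) (auto intro: continuous_on_subset)

text \<open>Integrating \<open>(h * x) ^ i\<close> and multiplying by \<open>h\<close> gives
  \<open>(h * c) ^ (i + 1) / (i + 1)\<close>, and the remainder gains a factor \<open>h\<close>.
  This gain of one order drives the bootstrapping.\<close>

lemma expandable_integral:
  assumes "expandable k g"
  shows "expandable (Suc k) (\<lambda>h c. h * integral {0..c} (g h))"
proof -
  from assms(1) obtain a where a: "\<And>i. i < k \<Longrightarrow> bnd 0 (\<lambda>h c. a i h)"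
    "bnd k (\<lambda>h c. g h c - (\<Sum>i<k. a i h * (h * c) ^ i))" unfolding expandable_def by blast
  let ?r = "\<lambda>h c. g h c - (\<Sum>i<k. a i h * (h * c) ^ i)"
  have E: "expandable (Suc k) (\<lambda>h c. h * integral {0..c} (?r h) +
      (\<Sum>i<k. (a i h * (1 / (real i + 1))) * (h * c) ^ Suc i))"
    by (intro expandable_add expandable_bnd bnd_step_mult bnd_integral a(2) expandable_sum
        expandable_monomial bnd_mult_right bnd_const) (auto intro: a)
  have "\<forall>\<^sub>F h in at_right 0. \<forall>c\<in>{0..1}. h * integral {0..c} (g h) =
      h * integral {0..c} (?r h) + (\<Sum>i<k. (a i h * (1 / (real i + 1))) * (h * c) ^ Suc i)"
    using bnd_continuous[OF a(2)]
  proof eventually_elim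
    case (elim h)
    show ?case
    proof
      fix c :: real assume c: "c \<in> {0..1}"
      have "((\<lambda>x. \<Sum>i<k. a i h * (h * x) ^ i) has_integral
          (\<Sum>i<k. a i h * h ^ i * (c ^ Suc i / (real i + 1)))) {0..c}"
        unfolding power_mult_distrib mult.assoc[symmetric]
        using c by (intro has_integral_sum has_integral_mult_right has_integral_power_interval) auto
      then have "integral {0..c} (\<lambda>x. \<Sum>i<k. a i h * (h * x) ^ i) =
          (\<Sum>i<k. a i h * h ^ i * (c ^ Suc i / (real i + 1)))"
        by (rule integral_unique)
      moreover have "integral {0..c} (\<lambda>x. ?r h x + (\<Sum>i<k. a i h * (h * x) ^ i)) =
          integral {0..c} (?r h) + integral {0..c} (\<lambda>x. \<Sum>i<k. a i h * (h * x) ^ i)"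
        by (rule integral_add_continuous[OF elim _ c]) (intro continuous_intros)
      moreover have "h * (\<Sum>i<k. a i h * h ^ i * (c ^ Suc i / (real i + 1))) =
          (\<Sum>i<k. (a i h * (1 / (real i + 1))) * (h * c) ^ Suc i)"
        by (simp add: sum_distrib_left power_mult_distrib mult_ac)
      ultimately show "h * integral {0..c} (g h) =
          h * integral {0..c} (?r h) + (\<Sum>i<k. (a i h * (1 / (real i + 1))) * (h * c) ^ Suc i)"
        by (simp add: distrib_left)
    qed
  qed
  with E show ?thesis by (rule expandable_cong)
qed

section \<open>The projection onto polynomials of degree below \<open>s\<close>\<close>

definition proj :: "nat \<Rightarrow> (real \<Rightarrow> real) \<Rightarrow> real \<Rightarrow> real" where
  "proj s g c = (\<Sum>i<s. Leg i c * integral {0..1} (\<lambda>x. Leg i x * g x))"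

lemma continuous_on_proj [continuous_intros]:
  "continuous_on A f \<Longrightarrow> continuous_on A (\<lambda>x. proj s g (f x))"
  unfolding proj_def by (intro continuous_intros)

lemma proj_add:
  assumes "continuous_on {0..1} f" "continuous_on {0..1} g"
  shows "proj s (\<lambda>x. f x + g x) c = proj s f c + proj s g c"
  by (simp add: proj_def distrib_left integral_add integrable_Leg_mult assms sum.distrib)

lemma proj_mult_left: "proj s (\<lambda>x. a * g x) c = a * proj s g c"
  by (simp add: proj_def sum_distrib_left mult.left_commute)

lemma proj_sum:
  assumes "\<And>i. i \<in> I \<Longrightarrow> continuous_on {0..1} (g i)"
  shows "proj s (\<lambda>x. \<Sum>i\<in>I. g i x) c = (\<Sum>i\<in>I. proj s (g i) c)"
  using assms
proof (induction I rule: infinite_finite_induct)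
  case (insert i I)
  then show ?case by (simp add: proj_add continuous_on_sum)
qed (simp_all add: proj_def)

lemma proj_Leg:
  assumes "j < s"
  shows "proj s (Leg j) c = Leg j c"
proof -
  have "proj s (Leg j) c = (\<Sum>i<s. if i = j then Leg i c else 0)"
    unfolding proj_def by (intro sum.cong) (auto simp: integral_Leg_mult_Leg)
  then show ?thesis using assms by simp
qed

lemma proj_power:
  assumes "n < s"
  shows "proj s (\<lambda>x. x ^ n) c = c ^ n"
proof -
  obtain b where "\<And>x. x ^ n = (\<Sum>j\<le>n. b j * Leg j x)" using power_in_span_Leg by blast
  then show ?thesis
    using assms by (simp add: proj_sum continuous_intros proj_mult_left proj_Leg)
qed

lemma integral_Leg_mult_proj:
  assumes "j < s"
  shows "integral {0..1} (\<lambda>x. Leg j x * proj s g x) = integral {0..1} (\<lambda>x. Leg j x * g x)"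
proof -
  have "integral {0..1} (\<lambda>x. Leg j x * proj s g x) =
      integral {0..1} (\<lambda>x. \<Sum>i<s. integral {0..1} (\<lambda>x. Leg i x * g x) * (Leg j x * Leg i x))"
    by (simp add: proj_def sum_distrib_left mult_ac)
  also have "\<dots> = (\<Sum>i<s. integral {0..1} (\<lambda>x. Leg i x * g x) * integral {0..1} (\<lambda>x. Leg j x * Leg i x))"
    by (subst integral_sum) (auto intro!: integrable_on_mult_right integrable_Leg_mult continuous_intros)
  finally show ?thesis
    using assms by (simp add: integral_Leg_mult_Leg if_distrib cong: if_cong)
qed

text \<open>The residual is orthogonal to each \<open>Leg j\<close> with \<open>j < s\<close>, and
  these span the powers below \<open>s\<close>.\<close>

lemma integral_power_mult_proj_residual:
  assumes "n < s" "continuous_on {0..1} g"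
  shows "integral {0..1} (\<lambda>x. x ^ n * (proj s g x - g x)) = 0"
proof -
  obtain b where b: "\<And>x. x ^ n = (\<Sum>j\<le>n. b j * Leg j x)" using power_in_span_Leg by blast
  have int: "(\<lambda>x. Leg j x * (proj s g x - g x)) integrable_on {0..1}" for j
    using assms by (intro integrable_Leg_mult continuous_intros)
  have "integral {0..1} (\<lambda>x. x ^ n * (proj s g x - g x)) =
      (\<Sum>j\<le>n. b j * integral {0..1} (\<lambda>x. Leg j x * (proj s g x - g x)))"
    by (simp add: b sum_distrib_right mult.assoc integral_sum int integrable_on_mult_right)
  also have "integral {0..1} (\<lambda>x. Leg j x * (proj s g x - g x)) = 0" if "j \<le> n" for j
  proof -
    have "integral {0..1} (\<lambda>x. Leg j x * (proj s g x - g x)) =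
        integral {0..1} (\<lambda>x. Leg j x * proj s g x) - integral {0..1} (\<lambda>x. Leg j x * g x)"
      unfolding right_diff_distrib
      by (intro integral_diff integrable_Leg_mult assms continuous_intros)
    then show ?thesis using that assms(1) by (simp add: integral_Leg_mult_proj)
  qed
  then have "(\<Sum>j\<le>n. b j * integral {0..1} (\<lambda>x. Leg j x * (proj s g x - g x))) = 0" by simp
  finally show ?thesis .
qed

lemma bnd_proj: "bnd k g \<Longrightarrow> bnd k (\<lambda>h. proj s (g h))"
  unfolding proj_def
  by (intro bnd_sum bnd_mult_left bnd_integral_unit bnd_fixed continuous_intros)

lemma proj_polynomial:
  "k \<le> s \<Longrightarrow> proj s (\<lambda>c. \<Sum>i<k. a i * (h * c) ^ i) c = (\<Sum>i<k. a i * (h * c) ^ i)"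
  by (simp add: proj_sum continuous_intros power_mult_distrib proj_mult_left proj_power
      flip: mult.assoc)

text \<open>The projection fixes polynomials of degree below \<open>s\<close>, so they may be
  subtracted inside it instead of outside.\<close>

lemma proj_remainder:
  assumes "k \<le> s" "continuous_on {0..1} f"
  shows "proj s f c - (\<Sum>i<k. a i * (h * c) ^ i) =
    proj s (\<lambda>c. f c - (\<Sum>i<k. a i * (h * c) ^ i)) c"
  using proj_add[of "\<lambda>c. f c - (\<Sum>i<k. a i * (h * c) ^ i)" "\<lambda>c. \<Sum>i<k. a i * (h * c) ^ i" s c] assms
  by (simp add: proj_polynomial continuous_intros)

text \<open>The polynomial part passes unchanged and only the remainder is projected. The condition
  \<open>k \<le> s\<close> is what limits the bootstrapping to order \<open>s\<close>.\<close>

lemma expandable_proj: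
  assumes "expandable k g" "k \<le> s"
  shows "expandable k (\<lambda>h. proj s (g h))"
proof -
  from assms(1) obtain a where a: "\<And>i. i < k \<Longrightarrow> bnd 0 (\<lambda>h c. a i h)"
    "bnd k (\<lambda>h c. g h c - (\<Sum>i<k. a i h * (h * c) ^ i))" unfolding expandable_def by blast
  have "bnd k (\<lambda>h c. proj s (g h) c - (\<Sum>i<k. a i h * (h * c) ^ i))"
  proof (rule bnd_cong[OF bnd_proj[OF a(2), of s]])
    show "\<forall>\<^sub>F h in at_right 0. \<forall>c\<in>{0..1}. proj s (g h) c - (\<Sum>i<k. a i h * (h * c) ^ i) =
        proj s (\<lambda>c. g h c - (\<Sum>i<k. a i h * (h * c) ^ i)) c"
      using bnd_continuous[OF expandable_imp_bnd[OF assms(1)]]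
      by eventually_elim (intro ballI proj_remainder assms(2))
  qed
  with a(1) show ?thesis unfolding expandable_def by blast
qed

lemma bnd_proj_residual:
  assumes "expandable s g"
  shows "bnd s (\<lambda>h c. proj s (g h) c - g h c)"
proof -
  from assms(1) obtain a where a: "\<And>i. i < s \<Longrightarrow> bnd 0 (\<lambda>h c. a i h)"
    "bnd s (\<lambda>h c. g h c - (\<Sum>i<s. a i h * (h * c) ^ i))" unfolding expandable_def by blast
  show ?thesis
  proof (rule bnd_cong[OF bnd_diff[OF bnd_proj[OF a(2)] a(2)]])
    show "\<forall>\<^sub>F h in at_right 0. \<forall>c\<in>{0..1}. proj s (g h) c - g h c =
      proj s (\<lambda>c. g h c - (\<Sum>i<s. a i h * (h * c) ^ i)) c - (g h c - (\<Sum>i<s. a i h * (h * c) ^ i))"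
      using bnd_continuous[OF expandable_imp_bnd[OF assms(1)]]
      by eventually_elim (simp flip: proj_remainder[OF order_refl])
  qed
qed

text \<open>The order doubling comes from residuals of this kind.\<close>

definition hidden :: "nat \<Rightarrow> (real \<Rightarrow> real \<Rightarrow> real) \<Rightarrow> bool" where
  "hidden s r \<longleftrightarrow> bnd s r \<and>
    (\<forall>K. expandable s K \<longrightarrow> bnd (2 * s) (\<lambda>h c. integral {0..1} (\<lambda>x. K h x * r h x)))"

lemma hidden_bnd:
  assumes "bnd (2 * s) r"
  shows "hidden s r"
  unfolding hidden_def
  by (auto intro!: bnd_mono[OF assms] bnd_integral_unit bnd_mult_left assms expandable_imp_bnd)

lemma integral_mult_add:
  fixes f g :: "real \<Rightarrow> real"
  assumes "continuous_on {0..1} K" "continuous_on {0..1} f" "continuous_on {0..1} g"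
  shows "integral {0..1} (\<lambda>x. K x * (f x + g x)) =
    integral {0..1} (\<lambda>x. K x * f x) + integral {0..1} (\<lambda>x. K x * g x)"
  unfolding distrib_left using assms
  by (intro integral_add integrable_continuous_interval continuous_intros)

lemma hidden_add:
  assumes "hidden s f" "hidden s g"
  shows "hidden s (\<lambda>h c. f h c + g h c)"
  unfolding hidden_def
proof (intro conjI allI impI)
  show "bnd s (\<lambda>h c. f h c + g h c)" using assms by (simp add: hidden_def bnd_add)
  fix K assume K: "expandable s K"
  have "bnd (2 * s) (\<lambda>h c. integral {0..1} (\<lambda>x. K h x * f h x) + integral {0..1} (\<lambda>x. K h x * g h x))"
    using assms K by (intro bnd_add) (auto simp: hidden_def)
  moreover have "\<forall>\<^sub>F h in at_right 0. \<forall>c\<in>{0..1::real}. integral {0..1} (\<lambda>x. K h x * (f h x + g h x)) =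
     integral {0..1} (\<lambda>x. K h x * f h x) + integral {0..1} (\<lambda>x. K h x * g h x)"
    using bnd_continuous[OF expandable_imp_bnd[OF K]] assms[unfolded hidden_def, THEN conjunct1, THEN bnd_continuous]
    by eventually_elim (simp add: integral_mult_add)
  ultimately show "bnd (2 * s) (\<lambda>h c. integral {0..1} (\<lambda>x. K h x * (f h x + g h x)))"
    by (rule bnd_cong)
qed

text \<open>The factor moves into the weight, because \<open>K * f\<close> is again expandable; for
  this \<open>hidden\<close> quantifies over all expandable weights.\<close>

lemma hidden_mult:
  assumes "expandable s f" "hidden s r"
  shows "hidden s (\<lambda>h c. f h c * r h c)"
  unfolding hidden_def
proof (intro conjI allI impI)
  show "bnd s (\<lambda>h c. f h c * r h c)"
    using assms by (auto simp: hidden_def intro: bnd_mult_left expandable_imp_bnd)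
  fix K assume "expandable s K"
  then have "expandable s (\<lambda>h c. K h c * f h c)" using assms(1) by (rule expandable_mult)
  with assms(2) show "bnd (2 * s) (\<lambda>h c. integral {0..1} (\<lambda>x. K h x * (f h x * r h x)))"
    unfolding hidden_def by (auto simp: mult.assoc)
qed

lemma hidden_sum:
  "(\<And>i. i \<in> I \<Longrightarrow> hidden s (r i)) \<Longrightarrow> hidden s (\<lambda>h c. \<Sum>i\<in>I. r i h c)"
  by (induction I rule: infinite_finite_induct) (auto intro: hidden_add hidden_bnd)

text \<open>Split the weight: its polynomial part is orthogonal to the residual, while its remainder
  and the residual are both of order \<open>s\<close>, so their product is of order
  \<open>2 * s\<close>.\<close>

lemma hidden_proj_residual:
  assumes "expandable s g"
  shows "hidden s (\<lambda>h c. proj s (g h) c - g h c)"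
  unfolding hidden_def
proof (intro conjI allI impI)
  show r: "bnd s (\<lambda>h c. proj s (g h) c - g h c)" using assms by (rule bnd_proj_residual)
  fix K assume K: "expandable s K"
  then obtain a where a: "\<And>i. i < s \<Longrightarrow> bnd 0 (\<lambda>h c. a i h)"
    "bnd s (\<lambda>h c. K h c - (\<Sum>i<s. a i h * (h * c) ^ i))" unfolding expandable_def by blast
  let ?R = "\<lambda>h c. K h c - (\<Sum>i<s. a i h * (h * c) ^ i)"
  have "bnd (2 * s) (\<lambda>h c. integral {0..1} (\<lambda>x. ?R h x * (proj s (g h) x - g h x)))"
    using bnd_integral_unit[OF bnd_mult[OF a(2) r]] by (simp add: mult_2)
  moreover have "\<forall>\<^sub>F h in at_right 0. \<forall>c\<in>{0..1::real}.
      integral {0..1} (\<lambda>x. K h x * (proj s (g h) x - g h x)) =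
      integral {0..1} (\<lambda>x. ?R h x * (proj s (g h) x - g h x))"
    using bnd_continuous[OF a(2)] bnd_continuous[OF expandable_imp_bnd[OF assms]]
  proof eventually_elim
    case (elim h)
    let ?d = "\<lambda>x. proj s (g h) x - g h x"
    have d: "continuous_on {0..1} ?d" using elim(2) by (intro continuous_intros)
    have "integral {0..1} (\<lambda>x. (\<Sum>i<s. a i h * (h * x) ^ i) * ?d x) =
        integral {0..1} (\<lambda>x. \<Sum>i<s. (a i h * h ^ i) * (x ^ i * ?d x))"
      by (simp only: sum_distrib_right power_mult_distrib mult.assoc)
    also have "\<dots> = (\<Sum>i<s. (a i h * h ^ i) * integral {0..1} (\<lambda>x. x ^ i * ?d x))"
      by (subst integral_sum)
        (use d in \<open>auto intro!: integrable_on_mult_right integrable_continuous_interval continuous_intros elim(2)\<close>)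
    also have "\<dots> = 0"
      by (simp add: integral_power_mult_proj_residual elim(2))
    finally have 0: "integral {0..1} (\<lambda>x. (\<Sum>i<s. a i h * (h * x) ^ i) * ?d x) = 0" .
    have "integral {0..1} (\<lambda>x. ?d x * (?R h x + (\<Sum>i<s. a i h * (h * x) ^ i))) =
        integral {0..1} (\<lambda>x. ?d x * ?R h x) + integral {0..1} (\<lambda>x. ?d x * (\<Sum>i<s. a i h * (h * x) ^ i))"
      by (rule integral_mult_add[OF d elim(1)]) (intro continuous_intros)
    with 0 show ?case by (simp add: mult.commute)
  qed
  ultimately show "bnd (2 * s) (\<lambda>h c. integral {0..1} (\<lambda>x. K h x * (proj s (g h) x - g h x)))"
    by (rule bnd_cong)
qed

section \<open>The linearised error equation\<close>

lemma integral_by_parts_unit: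
  fixes K D :: "real \<Rightarrow> real"
  assumes "continuous_on {0..1} K" "continuous_on {0..1} D"
  shows "integral {0..1} (\<lambda>x. K x * integral {0..x} D) =
    integral {0..1} (\<lambda>x. (integral {0..1} K - integral {0..x} K) * D x)"
proof -
  let ?k = "\<lambda>x. integral {0..x} K" and ?d = "\<lambda>x. integral {0..x} D"
  \<comment> \<open>The primitive of \<open>K\<close> is normalised to vanish at 1, that of
    \<open>D\<close> at 0; so \<open>?F\<close> vanishes at both ends and no boundary term
    remains.\<close>
  let ?F = "\<lambda>x. (?k x - ?k 1) * ?d x" and ?F' = "\<lambda>x. K x * ?d x - (?k 1 - ?k x) * D x"
  have cont: "continuous_on {0..1} ?k" "continuous_on {0..1} ?d"
    by (intro indefinite_integral_continuous_1 integrable_continuous_interval assms)+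
  have "(?F' has_integral ?F 1 - ?F 0) {0..1}"
  proof (rule fundamental_theorem_of_calculus)
    fix x :: real assume x: "x \<in> {0..1}"
    show "(?F has_vector_derivative ?F' x) (at x within {0..1})"
      unfolding has_real_derivative_iff_has_vector_derivative[symmetric]
      by (rule derivative_eq_intros integral_has_real_derivative assms x refl)+
        (simp add: algebra_simps)
  qed simp
  then have "integral {0..1} ?F' = 0"
    by (simp add: integral_unique)
  moreover have "integral {0..1} ?F' = integral {0..1} (\<lambda>x. K x * ?d x) -
      integral {0..1} (\<lambda>x. (?k 1 - ?k x) * D x)"
    by (intro integral_diff integrable_continuous_interval continuous_intros assms cont)
  ultimately show ?thesis by simp
qed

section \<open>A priori bounds relative to an unknown error\<close>

lemma bnd_abs: "bnd k g \<Longrightarrow> bnd k (\<lambda>h c. \<bar>g h c\<bar>)"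
  by (rule bnd_dominated[where f = g])
    (auto elim: eventually_mono[OF bnd_continuous] intro: continuous_intros)

text \<open>\<open>S\<close> will be the total error plus \<open>h ^ s\<close>. Its order in
  \<open>h\<close> is what is to be determined, so \<open>bnd\<close> cannot express the
  bound.\<close>

definition dominated :: "(real \<Rightarrow> real \<Rightarrow> real) \<Rightarrow> (real \<Rightarrow> real \<Rightarrow> real) \<Rightarrow> bool" where
  "dominated S g \<longleftrightarrow> (\<exists>C\<ge>0. \<forall>\<^sub>F h in at_right 0. \<forall>c\<in>{0..1}. \<bar>g h c\<bar> \<le> C * S h c)"

lemma dominatedE:
  assumes "dominated S g"
  obtains C where "C \<ge> 0" "\<forall>\<^sub>F h in at_right 0. \<forall>c\<in>{0..1}. \<bar>g h c\<bar> \<le> C * S h c"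
  using assms unfolding dominated_def by blast

lemma dominated_add:
  assumes "dominated S f" "dominated S g"
  shows "dominated S (\<lambda>h c. f h c + g h c)"
proof -
  obtain C where C: "C \<ge> 0" "\<forall>\<^sub>F h in at_right 0. \<forall>c\<in>{0..1}. \<bar>f h c\<bar> \<le> C * S h c"
    using assms(1) by (rule dominatedE)
  obtain D where D: "D \<ge> 0" "\<forall>\<^sub>F h in at_right 0. \<forall>c\<in>{0..1}. \<bar>g h c\<bar> \<le> D * S h c"
    using assms(2) by (rule dominatedE)
  have "\<forall>\<^sub>F h in at_right 0. \<forall>c\<in>{0..1}. \<bar>f h c + g h c\<bar> \<le> (C + D) * S h c"
    using C(2) D(2)
  proof eventually_elim
    case (elim h)
    show ?case
    proof
      fix c :: real assume "c \<in> {0..1}"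
      with elim have "\<bar>f h c\<bar> \<le> C * S h c" "\<bar>g h c\<bar> \<le> D * S h c" by auto
      then show "\<bar>f h c + g h c\<bar> \<le> (C + D) * S h c" by (simp add: distrib_right)
    qed
  qed
  with C(1) D(1) show ?thesis unfolding dominated_def by (intro exI[of _ "C + D"]) simp
qed

lemma dominated_mult:
  assumes "bnd 0 f" "dominated S g"
  shows "dominated S (\<lambda>h c. f h c * g h c)"
proof -
  obtain C where C: "C > 0" "\<forall>\<^sub>F h in at_right 0. 0 < h \<and> h < 1 \<and>
      continuous_on {0..1} (f h) \<and> (\<forall>c\<in>{0..1}. \<bar>f h c\<bar> \<le> C * h ^ 0)"
    using assms(1) by (rule bndE)
  obtain D where D: "D \<ge> 0" "\<forall>\<^sub>F h in at_right 0. \<forall>c\<in>{0..1}. \<bar>g h c\<bar> \<le> D * S h c"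
    using assms(2) by (rule dominatedE)
  have "\<forall>\<^sub>F h in at_right 0. \<forall>c\<in>{0..1}. \<bar>f h c * g h c\<bar> \<le> (C * D) * S h c"
    using C(2) D(2)
  proof eventually_elim
    case (elim h)
    show ?case
    proof
      fix c :: real assume "c \<in> {0..1}"
      then have "\<bar>f h c\<bar> * \<bar>g h c\<bar> \<le> C * (D * S h c)"
        using elim C(1) by (intro mult_mono) auto
      then show "\<bar>f h c * g h c\<bar> \<le> (C * D) * S h c" by (simp add: abs_mult mult.assoc)
    qed
  qed
  with C(1) D(1) show ?thesis unfolding dominated_def by (intro exI[of _ "C * D"]) simp
qed

lemma dominated_trans:
  assumes "dominated T f" "dominated S T"
  shows "dominated S f"
proof -
  obtain C where C: "C \<ge> 0" "\<forall>\<^sub>F h in at_right 0. \<forall>c\<in>{0..1}. \<bar>f h c\<bar> \<le> C * T h c"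
    using assms(1) by (rule dominatedE)
  obtain D where D: "D \<ge> 0" "\<forall>\<^sub>F h in at_right 0. \<forall>c\<in>{0..1}. \<bar>T h c\<bar> \<le> D * S h c"
    using assms(2) by (rule dominatedE)
  have "\<forall>\<^sub>F h in at_right 0. \<forall>c\<in>{0..1}. \<bar>f h c\<bar> \<le> (C * D) * S h c"
    using C(2) D(2)
  proof eventually_elim
    case (elim h)
    show ?case
    proof
      fix c :: real assume c: "c \<in> {0..1}"
      with elim(2) have "T h c \<le> D * S h c" by fastforce
      then have "C * T h c \<le> C * (D * S h c)"
        using C(1) by (rule mult_left_mono)
      then show "\<bar>f h c\<bar> \<le> (C * D) * S h c"
        using elim(1) c by (auto simp: mult.assoc intro: order_trans)
    qed
  qed
  with C(1) D(1) show ?thesis unfolding dominated_def by (intro exI[of _ "C * D"]) simp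
qed

lemma dominated_abs: "dominated S g \<Longrightarrow> dominated S (\<lambda>h c. \<bar>g h c\<bar>)"
  by (simp add: dominated_def)

lemma dominated_diff:
  "dominated S f \<Longrightarrow> dominated S g \<Longrightarrow> dominated S (\<lambda>h c. f h c - g h c)"
  using dominated_add[of S f "\<lambda>h c. -1 * g h c"] dominated_mult[OF bnd_const[of "-1"], of S g] by simp

lemma dominated_zero [simp]: "dominated S (\<lambda>h c. 0)"
  unfolding dominated_def by (intro exI[of _ 0]) simp

lemma dominated_sum:
  "(\<And>i. i \<in> I \<Longrightarrow> dominated S (g i)) \<Longrightarrow> dominated S (\<lambda>h c. \<Sum>i\<in>I. g i h c)"
  by (induction I rule: infinite_finite_induct) (auto intro: dominated_add)

text \<open>The factor \<open>h\<close> replaces a Gronwall argument: where the total error is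
  largest, the equation bounds it by a small multiple of itself plus \<open>h ^ s\<close>, and the
  error term is absorbed on the left.\<close>

lemma bnd_of_dominated_integral_equation:
  fixes e D :: "'i \<Rightarrow> real \<Rightarrow> real \<Rightarrow> real"
  assumes "finite I"
    and e: "\<And>i. i \<in> I \<Longrightarrow> bnd 0 (e i)"
    and contD: "\<And>i. i \<in> I \<Longrightarrow> \<forall>\<^sub>F h in at_right 0. continuous_on {0..1} (D i h)"
    and dom: "\<And>i. i \<in> I \<Longrightarrow> dominated (\<lambda>h c. (\<Sum>j\<in>I. \<bar>e j h c\<bar>) + h ^ s) (D i)"
    and eq: "\<And>i. i \<in> I \<Longrightarrow> \<forall>\<^sub>F h in at_right 0. \<forall>c\<in>{0..1}. e i h c = h * integral {0..c} (D i h)"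
    and "i \<in> I"
  shows "bnd s (e i)"
proof -
  define S where "S h c = (\<Sum>j\<in>I. \<bar>e j h c\<bar>)" for h c
  have "dominated (\<lambda>h c. S h c + h ^ s) (\<lambda>h c. \<Sum>i\<in>I. \<bar>D i h c\<bar>)"
    using dom unfolding S_def[symmetric] by (intro dominated_sum) (simp add: dominated_def)
  then obtain L where L: "L \<ge> 0" "\<forall>\<^sub>F h in at_right 0. \<forall>c\<in>{0..1}.
      \<bar>\<Sum>i\<in>I. \<bar>D i h c\<bar>\<bar> \<le> L * (S h c + h ^ s)" by (rule dominatedE)
  have S: "bnd 0 S" unfolding S_def by (intro bnd_sum bnd_abs e)
  define n where "n = real (card I)"
  have n: "n \<ge> 0" by (simp add: n_def)
  \<comment> \<open>The threshold forces \<open>h * (n * L)\<close> below \<open>1 / 2\<close>; the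
    \<open>+ 1\<close> keeps the denominator positive when \<open>n * L = 0\<close>.\<close>
  have "\<forall>\<^sub>F h in at_right 0. 0 < h \<and> h < 1 / (2 * (n * L + 1))"
    using n L(1) by (intro eventually_at_right_0_small) (simp add: add_nonneg_pos)
  moreover have "\<forall>\<^sub>F h in at_right 0. \<forall>i\<in>I. continuous_on {0..1} (D i h)"
    by (intro eventually_ball_finite[OF \<open>finite I\<close>] ballI contD)
  moreover have "\<forall>\<^sub>F h in at_right 0. \<forall>i\<in>I. \<forall>c\<in>{0..1}. e i h c = h * integral {0..c} (D i h)"
    by (rule eventually_ball_finite[OF \<open>finite I\<close>], rule ballI, rule eq)
  ultimately have "\<forall>\<^sub>F h in at_right 0. \<forall>c\<in>{0..1}. S h c \<le> 1 * h ^ s"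
    using L(2) bnd_continuous[OF S]
  proof eventually_elim
    case (elim h)
    obtain m where m: "m \<in> {0..1}" "\<forall>c\<in>{0..1}. S h c \<le> S h m"
      using continuous_attains_sup[of "{0..1::real}" "S h"] elim(5) by auto
    have S0: "0 \<le> S h m" by (simp add: S_def sum_nonneg)
    have h: "h > 0" using elim by simp
    have "\<bar>e i h m\<bar> \<le> h * (L * (S h m + h ^ s))" if "i \<in> I" for i
    proof -
      have "norm (integral {0..m} (D i h)) \<le> L * (S h m + h ^ s) * (m - 0)"
      proof (rule integral_bound)
        show "continuous_on {0..m} (D i h)"
          using elim(2) that m(1) by (auto intro: continuous_on_subset)
        fix t assume "t \<in> {0..m}"
        then have t: "t \<in> {0..1}" using m(1) by auto
        have "\<bar>D i h t\<bar> \<le> (\<Sum>i\<in>I. \<bar>D i h t\<bar>)"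
          using that by (intro member_le_sum \<open>finite I\<close>) auto
        also have "\<dots> \<le> L * (S h t + h ^ s)" using elim(4) t by auto
        also have "\<dots> \<le> L * (S h m + h ^ s)" using m(2) t L(1) by (intro mult_left_mono) auto
        finally show "norm (D i h t) \<le> L * (S h m + h ^ s)" by simp
      qed (use m in simp)
      also have "\<dots> \<le> L * (S h m + h ^ s) * 1"
        using m(1) L(1) S0 h by (intro mult_left_mono) auto
      finally have "h * \<bar>integral {0..m} (D i h)\<bar> \<le> h * (L * (S h m + h ^ s))"
        using h by (intro mult_left_mono) auto
      then show ?thesis using elim(3) that m(1) h by (simp add: abs_mult)
    qed
    then have "S h m \<le> (\<Sum>i\<in>I. h * (L * (S h m + h ^ s)))"
      unfolding S_def[of h m] by (rule sum_mono)
    also have "\<dots> = (h * (n * L)) * (S h m + h ^ s)" by (simp add: n_def)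
    also have "\<dots> \<le> (1 / 2) * (S h m + h ^ s)"
    proof (rule mult_right_mono)
      have "h * (2 * (n * L + 1)) < 1"
        using elim(1) n L(1) by (simp add: pos_less_divide_eq add_nonneg_pos)
      then show "h * (n * L) \<le> 1 / 2" using h by (simp add: algebra_simps)
    qed (use S0 h in simp)
    finally have "S h m \<le> h ^ s" by simp
    with m(2) show ?case by (auto intro: order_trans)
  qed
  moreover have "\<bar>e i h c\<bar> \<le> S h c" for h c
    unfolding S_def using \<open>i \<in> I\<close> by (intro member_le_sum \<open>finite I\<close>) auto
  ultimately have "\<forall>\<^sub>F h in at_right 0. \<forall>c\<in>{0..1}. \<bar>e i h c\<bar> \<le> 1 * h ^ s"
    by (elim eventually_mono) (auto intro: order_trans)
  then show ?thesis
    using bnd_continuous[OF e[OF \<open>i \<in> I\<close>]] by (intro bndI)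
qed

section \<open>Order doubling at the endpoint for a linear system\<close>

context
  fixes I :: "'i set" and s :: nat
    and e r :: "'i \<Rightarrow> real \<Rightarrow> real \<Rightarrow> real" and M :: "'i \<Rightarrow> 'i \<Rightarrow> real \<Rightarrow> real \<Rightarrow> real"
  assumes finite_I: "finite I"
    and e: "\<And>i. i \<in> I \<Longrightarrow> bnd s (e i)"
    and M: "\<And>i j. i \<in> I \<Longrightarrow> j \<in> I \<Longrightarrow> expandable s (M i j)"
    and r: "\<And>i. i \<in> I \<Longrightarrow> hidden s (r i)"
    and eq: "\<And>i. i \<in> I \<Longrightarrow> \<forall>\<^sub>F h in at_right 0. \<forall>c\<in>{0..1}.
      e i h c = h * integral {0..c} (\<lambda>x. (\<Sum>j\<in>I. M i j h x * e j h x) + r i h x)"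
begin

lemma eventually_continuous_system:
  "\<forall>\<^sub>F h in at_right 0. \<forall>i\<in>I. continuous_on {0..1} (e i h) \<and> continuous_on {0..1} (r i h) \<and>
    (\<forall>j\<in>I. continuous_on {0..1} (M i j h))"
  using bnd_continuous[OF e] bnd_continuous[OF expandable_imp_bnd[OF M]]
    r[unfolded hidden_def, THEN conjunct1, THEN bnd_continuous]
  by (intro eventually_ball_finite finite_I ballI eventually_conj) auto

text \<open>By parts, \<open>\<integral> K e = \<integral> N e' / h\<close> with \<open>N = h \<integral> K\<close>, so each use of the equation gains
  one power of \<open>h\<close> in the weight at the cost of a term \<open>\<integral> N r\<close>.\<close>

lemma bnd_integral_weighted_error:
  assumes "n \<le> s" "\<And>i. i \<in> I \<Longrightarrow> expandable s (K i)" "\<And>i. i \<in> I \<Longrightarrow> bnd (s - n) (K i)"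
  shows "bnd (2 * s) (\<lambda>h c. integral {0..1} (\<lambda>x. \<Sum>i\<in>I. K i h x * e i h x))"
  using assms
proof (induction n arbitrary: K)
  \<comment> \<open>\<open>n\<close> counts the powers of \<open>h\<close> that the weight may lack.
    Here it has all \<open>s\<close> of them, and \<open>e\<close> contributes the other
    \<open>s\<close>.\<close>
  case 0
  then show ?case
    unfolding mult_2 by (intro bnd_integral_unit bnd_sum bnd_mult e) auto
next
  case (Suc n)
  \<comment> \<open>This is \<open>h\<close> times the integral of \<open>K i h\<close> from
    \<open>c\<close> to 1. It vanishes at 1 and \<open>e\<close> vanishes at 0, so integration by
    parts has no boundary terms.\<close>
  define N where "N i h c = h * integral {0..1} (K i h) - h * integral {0..c} (K i h)" for i h c
  have N_exp: "expandable s (N i)" if "i \<in> I" for i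
    unfolding N_def using that
    by (intro expandable_diff expandable_step_const bnd_mono[OF bnd_step_mult[OF bnd_integral_unit[where k = 0]]]
        expandable_mono[OF expandable_integral[where k = s]] expandable_imp_bnd[OF Suc.prems(2)] Suc.prems(2)) auto
  have N_bnd: "bnd (s - n) (N i)" if "i \<in> I" for i
  proof -
    have "bnd (Suc (s - Suc n)) (N i)"
      unfolding N_def using that
      by (intro bnd_diff bnd_step_mult bnd_integral_unit bnd_integral Suc.prems(3))
    then show ?thesis using Suc.prems(1) by (simp add: Suc_diff_Suc)
  qed
  \<comment> \<open>The new weights are the transposed matrix applied to \<open>N\<close>; they have
    gained one power of \<open>h\<close>, as the induction hypothesis requires.\<close>
  have "bnd (2 * s) (\<lambda>h c. integral {0..1} (\<lambda>x. \<Sum>j\<in>I. (\<Sum>i\<in>I. N i h x * M i j h x) * e j h x))"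
    using Suc.prems(1)
    by (intro Suc.IH expandable_sum bnd_sum expandable_mult bnd_mult_right N_exp N_bnd M
        expandable_imp_bnd[OF M]) auto
  moreover have "bnd (2 * s) (\<lambda>h c. \<Sum>i\<in>I. integral {0..1} (\<lambda>x. N i h x * r i h x))"
    using r N_exp by (intro bnd_sum) (auto simp: hidden_def)
  ultimately have total: "bnd (2 * s) (\<lambda>h c.
      integral {0..1} (\<lambda>x. \<Sum>j\<in>I. (\<Sum>i\<in>I. N i h x * M i j h x) * e j h x) +
      (\<Sum>i\<in>I. integral {0..1} (\<lambda>x. N i h x * r i h x)))"
    by (rule bnd_add)
  have "\<forall>\<^sub>F h in at_right 0. \<forall>i\<in>I. continuous_on {0..1} (K i h) \<and> continuous_on {0..1} (N i h)"
    using bnd_continuous[OF expandable_imp_bnd[OF Suc.prems(2)]]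
      bnd_continuous[OF expandable_imp_bnd[OF N_exp]]
    by (intro eventually_ball_finite finite_I ballI eventually_conj) auto
  moreover have "\<forall>\<^sub>F h in at_right 0. \<forall>i\<in>I. \<forall>c\<in>{0..1}.
      e i h c = h * integral {0..c} (\<lambda>x. (\<Sum>j\<in>I. M i j h x * e j h x) + r i h x)"
    by (rule eventually_ball_finite[OF finite_I], rule ballI, rule eq)
  ultimately have "\<forall>\<^sub>F h in at_right 0. \<forall>c\<in>{0..1::real}.
      integral {0..1} (\<lambda>x. \<Sum>i\<in>I. K i h x * e i h x) =
      integral {0..1} (\<lambda>x. \<Sum>j\<in>I. (\<Sum>i\<in>I. N i h x * M i j h x) * e j h x) +
      (\<Sum>i\<in>I. integral {0..1} (\<lambda>x. N i h x * r i h x))"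
    using eventually_continuous_system
  proof eventually_elim
    case (elim h)
    have contK: "continuous_on {0..1} (K i h)" and contN: "continuous_on {0..1} (N i h)"
      and conte: "continuous_on {0..1} (e i h)" and contr: "continuous_on {0..1} (r i h)" if "i \<in> I" for i
      using elim that by auto
    have contM: "continuous_on {0..1} (M i j h)" if "i \<in> I" "j \<in> I" for i j
      using elim that by auto
    let ?D = "\<lambda>i x. (\<Sum>j\<in>I. M i j h x * e j h x) + r i h x"
    have contD: "continuous_on {0..1} (?D i)" if "i \<in> I" for i
      using that by (intro continuous_intros contM conte contr)
    have parts: "integral {0..1} (\<lambda>x. K i h x * e i h x) =
        integral {0..1} (\<lambda>x. N i h x * (\<Sum>j\<in>I. M i j h x * e j h x)) + integral {0..1} (\<lambda>x. N i h x * r i h x)"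
      if i: "i \<in> I" for i
    proof -
      have "integral {0..1} (\<lambda>x. K i h x * e i h x) =
          integral {0..1} (\<lambda>x. h * (K i h x * integral {0..x} (?D i)))"
        using elim(2) i by (intro integral_cong) simp
      also have "\<dots> = h * integral {0..1} (\<lambda>x. (integral {0..1} (K i h) - integral {0..x} (K i h)) * ?D i x)"
        by (simp add: integral_by_parts_unit[OF contK[OF i] contD[OF i]])
      also have "\<dots> = integral {0..1} (\<lambda>x. N i h x * ?D i x)"
        by (simp only: N_def right_diff_distrib[symmetric] mult.assoc integral_mult_right)
      also have "\<dots> = integral {0..1} (\<lambda>x. N i h x * (\<Sum>j\<in>I. M i j h x * e j h x)) +
          integral {0..1} (\<lambda>x. N i h x * r i h x)"
        using i by (intro integral_mult_add continuous_intros contN contM conte contr)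
      finally show ?thesis .
    qed
    have "integral {0..1} (\<lambda>x. \<Sum>i\<in>I. K i h x * e i h x) = (\<Sum>i\<in>I. integral {0..1} (\<lambda>x. K i h x * e i h x))"
      by (intro integral_sum finite_I integrable_continuous_interval continuous_intros contK conte)
    also have "\<dots> = (\<Sum>i\<in>I. integral {0..1} (\<lambda>x. N i h x * (\<Sum>j\<in>I. M i j h x * e j h x))) +
        (\<Sum>i\<in>I. integral {0..1} (\<lambda>x. N i h x * r i h x))"
      by (simp add: parts sum.distrib)
    also have "(\<Sum>i\<in>I. integral {0..1} (\<lambda>x. N i h x * (\<Sum>j\<in>I. M i j h x * e j h x))) =
        integral {0..1} (\<lambda>x. \<Sum>i\<in>I. N i h x * (\<Sum>j\<in>I. M i j h x * e j h x))"
      by (intro integral_sum[symmetric] finite_I integrable_continuous_interval continuous_intros contN contM conte)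
    also have "(\<lambda>x. \<Sum>i\<in>I. N i h x * (\<Sum>j\<in>I. M i j h x * e j h x)) =
        (\<lambda>x. \<Sum>j\<in>I. (\<Sum>i\<in>I. N i h x * M i j h x) * e j h x)"
      unfolding sum_distrib_left sum_distrib_right mult.assoc by (rule ext, rule sum.swap)
    finally show ?case by simp
  qed
  with total show ?case by (rule bnd_cong)
qed

text \<open>The row \<open>M i\<close> is a weight without any decay, so the weighted estimate is
  used with \<open>n = s\<close>, and the residual is tested against the weight 1. The factor
  \<open>h\<close> in \<open>eq\<close> gives the final power.\<close>

lemma bnd_error_end:
  assumes i: "i \<in> I"
  shows "bnd (2 * s + 1) (\<lambda>h c. e i h 1)"
proof -
  have "bnd (2 * s) (\<lambda>h c. integral {0..1} (\<lambda>x. \<Sum>j\<in>I. M i j h x * e j h x))"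
    by (rule bnd_integral_weighted_error[of s]) (auto intro: M i expandable_imp_bnd)
  moreover have "bnd (2 * s) (\<lambda>h c. integral {0..1} (\<lambda>x. 1 * r i h x))"
    using r[OF i] expandable_const[of s 1] unfolding hidden_def by blast
  ultimately have "bnd (Suc (2 * s)) (\<lambda>h c. h * (integral {0..1} (\<lambda>x. \<Sum>j\<in>I. M i j h x * e j h x) +
      integral {0..1} (\<lambda>x. r i h x)))"
    by (intro bnd_step_mult bnd_add) simp_all
  moreover have "\<forall>\<^sub>F h in at_right 0. \<forall>c\<in>{0..1::real}. e i h 1 =
      h * (integral {0..1} (\<lambda>x. \<Sum>j\<in>I. M i j h x * e j h x) + integral {0..1} (\<lambda>x. r i h x))"
    using eq[OF i] eventually_continuous_system
  proof eventually_elim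
    case (elim h)
    then have "integral {0..1} (\<lambda>x. (\<Sum>j\<in>I. M i j h x * e j h x) + r i h x) =
        integral {0..1} (\<lambda>x. \<Sum>j\<in>I. M i j h x * e j h x) + integral {0..1} (r i h)"
      using i by (intro integral_add integrable_continuous_interval continuous_intros) auto
    with elim(1) show ?case by simp
  qed
  ultimately show ?thesis by (simp add: bnd_cong)
qed

end

section \<open>Smooth functions along a family\<close>

definition partial :: "'m \<Rightarrow> (real^'m \<Rightarrow> real) \<Rightarrow> real^'m \<Rightarrow> real" where
  "partial l \<phi> x = frechet_derivative \<phi> (at x) (axis l 1)"

lemma ideriv_append: "ideriv vs (ideriv ws f) = ideriv (vs @ ws) f"
  by (induction vs) simp_all

lemma smooth_on_partial: "smooth_on UNIV \<phi> \<Longrightarrow> smooth_on UNIV (partial l \<phi>)"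
proof -
  assume "smooth_on UNIV \<phi>"
  moreover have "partial l \<phi> = ideriv [axis l 1] \<phi>"
    by (rule ext) (simp add: partial_def)
  ultimately show ?thesis
    by (simp only: smooth_on_def ideriv_append) simp
qed

lemma smooth_on_differentiable: "smooth_on S f \<Longrightarrow> x \<in> S \<Longrightarrow> f differentiable (at x)"
  unfolding smooth_on_def by (metis ideriv.simps(1))

lemma smooth_on_continuous: "smooth_on S f \<Longrightarrow> continuous_on S f"
  by (meson smooth_on_differentiable differentiable_imp_continuous_within continuous_at_imp_continuous_on)

lemma sum_scaleR_axis: "(\<Sum>l\<in>UNIV. f l *\<^sub>R axis l (1::real)) = (\<chi> l. f l)"
  using basis_expansion[of "\<chi> l. f l"] by (simp add: scalar_mult_eq_scaleR)

lemma smooth_on_has_derivative: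
  fixes \<phi> :: "real^'m \<Rightarrow> real"
  assumes "smooth_on UNIV \<phi>"
  shows "(\<phi> has_derivative (\<lambda>v. \<Sum>l\<in>UNIV. partial l \<phi> x * v $ l)) (at x within S)"
proof -
  let ?D = "frechet_derivative \<phi> (at x)"
  have D: "(\<phi> has_derivative ?D) (at x)"
    using smooth_on_differentiable[OF assms] by (simp add: frechet_derivative_works)
  then interpret bounded_linear ?D by (rule has_derivative_bounded_linear)
  have "?D = (\<lambda>v. \<Sum>l\<in>UNIV. partial l \<phi> x * v $ l)"
  proof
    fix v :: "real^'m"
    have "?D v = ?D (\<Sum>l\<in>UNIV. v $ l *\<^sub>R axis l 1)"
      by (simp add: sum_scaleR_axis)
    also have "\<dots> = (\<Sum>l\<in>UNIV. v $ l * ?D (axis l 1))"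
      by (simp add: sum scaleR)
    finally show "?D v = (\<Sum>l\<in>UNIV. partial l \<phi> x * v $ l)"
      by (simp add: partial_def mult.commute)
  qed
  with D show ?thesis by (metis has_derivative_at_withinI)
qed

text \<open>A bounded linear map commutes with all iterated derivatives. This gives smoothness of
  the entries of the matrix-valued \<open>B\<close>.\<close>

lemma smooth_on_bounded_linear:
  assumes "bounded_linear L" "smooth_on UNIV f"
  shows "smooth_on UNIV (\<lambda>x. L (f x))"
proof -
  interpret bounded_linear L by fact
  have dif: "ideriv vs f differentiable (at x)" for vs x
    using assms(2) by (simp add: smooth_on_def)
  have "ideriv vs (\<lambda>x. L (f x)) = (\<lambda>x. L (ideriv vs f x))" for vs
  proof (induction vs)
    case (Cons v vs)
    have "((\<lambda>x. L (ideriv vs f x)) has_derivative (\<lambda>w. L (frechet_derivative (ideriv vs f) (at x) w))) (at x)" for x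
      using dif by (intro has_derivative) (simp add: frechet_derivative_works)
    from frechet_derivative_at[OF this, symmetric] show ?case
      by (simp add: Cons)
  qed simp
  then show ?thesis
    using dif by (auto simp: smooth_on_def intro: differentiable_compose bounded_linear_imp_differentiable[OF assms(1)])
qed

lemma smooth_on_vec_nth: "smooth_on UNIV f \<Longrightarrow> smooth_on UNIV (\<lambda>x. f x $ i)"
  by (rule smooth_on_bounded_linear[OF bounded_linear_vec_nth])

lemma onorm_coordinate_sum_le:
  fixes a :: "'m::finite \<Rightarrow> real"
  shows "onorm (\<lambda>v::real^'m. \<Sum>l\<in>UNIV. a l * v $ l) \<le> (\<Sum>l\<in>UNIV. \<bar>a l\<bar>)"
proof (rule onorm_le)
  fix v :: "real^'m"
  have "\<bar>\<Sum>l\<in>UNIV. a l * v $ l\<bar> \<le> (\<Sum>l\<in>UNIV. \<bar>a l\<bar> * norm v)"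
    by (intro order_trans[OF sum_abs] sum_mono) (simp add: abs_mult mult_left_mono component_le_norm_cart)
  then show "norm (\<Sum>l\<in>UNIV. a l * v $ l) \<le> (\<Sum>l\<in>UNIV. \<bar>a l\<bar>) * norm v"
    by (simp add: sum_distrib_right)
qed

lemma smooth_on_Lipschitz_cball:
  fixes \<phi> :: "real^'m \<Rightarrow> real"
  assumes "smooth_on UNIV \<phi>"
  obtains L where "L \<ge> 0" "\<And>a b. a \<in> cball 0 R \<Longrightarrow> b \<in> cball 0 R \<Longrightarrow> \<bar>\<phi> a - \<phi> b\<bar> \<le> L * norm (a - b)"
proof -
  have "continuous_on UNIV (\<lambda>x. \<Sum>l\<in>UNIV. \<bar>partial l \<phi> x\<bar>)"
    by (intro continuous_intros smooth_on_continuous smooth_on_partial assms)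
  then have "bounded ((\<lambda>x. \<Sum>l\<in>UNIV. \<bar>partial l \<phi> x\<bar>) ` cball 0 R)"
    by (intro compact_imp_bounded compact_continuous_image) (auto intro: continuous_on_subset)
  then obtain L where L: "\<And>x. x \<in> cball 0 R \<Longrightarrow> norm (\<Sum>l\<in>UNIV. \<bar>partial l \<phi> x\<bar>) \<le> L"
    unfolding bounded_iff by blast
  have "norm (\<phi> a - \<phi> b) \<le> max L 0 * norm (a - b)" if "a \<in> cball 0 R" "b \<in> cball 0 R" for a b
  proof (rule differentiable_bound[OF convex_cball smooth_on_has_derivative[OF assms] _ that])
    fix x :: "real^'m" assume "x \<in> cball 0 R"
    with L[of x] show "onorm (\<lambda>v. \<Sum>l\<in>UNIV. partial l \<phi> x * v $ l) \<le> max L 0"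
      using onorm_coordinate_sum_le[of "\<lambda>l. partial l \<phi> x"] by simp
  qed
  then show thesis by (intro that[of "max L 0"]) auto
qed

text \<open>Along the segment the derivative varies by at most the Lipschitz constants of the
  partial derivatives times the length. The expansion is centred at \<open>a\<close>, later a point
  of the scheme.\<close>

lemma smooth_on_second_order_cball:
  fixes \<phi> :: "real^'m \<Rightarrow> real"
  assumes "smooth_on UNIV \<phi>"
  obtains C where "C \<ge> 0" "\<And>a b. a \<in> cball 0 R \<Longrightarrow> b \<in> cball 0 R \<Longrightarrow>
    \<bar>\<phi> a - \<phi> b - (\<Sum>l\<in>UNIV. partial l \<phi> a * (a - b) $ l)\<bar> \<le> C * (norm (a - b))\<^sup>2"
proof -
  have "\<exists>L\<ge>0. \<forall>a\<in>cball 0 R. \<forall>b\<in>cball 0 R. \<bar>partial l \<phi> a - partial l \<phi> b\<bar> \<le> L * norm (a - b)" for l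
    by (rule smooth_on_Lipschitz_cball[OF smooth_on_partial[OF assms, of l], of R]) blast
  then have "\<forall>l. \<exists>L\<ge>0. \<forall>a\<in>cball 0 R. \<forall>b\<in>cball 0 R. \<bar>partial l \<phi> a - partial l \<phi> b\<bar> \<le> L * norm (a - b)"
    by blast
  then obtain L where "\<forall>l. L l \<ge> 0 \<and> (\<forall>a\<in>cball 0 R. \<forall>b\<in>cball 0 R.
      \<bar>partial l \<phi> a - partial l \<phi> b\<bar> \<le> L l * norm (a - b))"
    unfolding choice_iff by blast
  then have L: "\<And>l. L l \<ge> 0" "\<And>l a b. a \<in> cball 0 R \<Longrightarrow> b \<in> cball 0 R \<Longrightarrow>
      \<bar>partial l \<phi> a - partial l \<phi> b\<bar> \<le> L l * norm (a - b)" by blast+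
  have "\<bar>\<phi> a - \<phi> b - (\<Sum>l\<in>UNIV. partial l \<phi> a * (a - b) $ l)\<bar> \<le> (\<Sum>l\<in>UNIV. L l) * (norm (a - b))\<^sup>2"
    if ab: "a \<in> cball 0 R" "b \<in> cball 0 R" for a b
  proof -
    let ?S = "closed_segment a b"
    let ?f' = "\<lambda>x (v::real^'m). \<Sum>l\<in>UNIV. partial l \<phi> x * v $ l"
    have "norm (\<phi> b - \<phi> a - ?f' a (b - a)) \<le> norm (b - a) * ((\<Sum>l\<in>UNIV. L l) * norm (a - b))"
    proof (rule differentiable_bound_linearization[where S = ?S])
      show "a + t *\<^sub>R (b - a) \<in> ?S" if "t \<in> {0..1}" for t
        using that by (auto simp: in_segment algebra_simps)
      show "(\<phi> has_derivative ?f' x) (at x within ?S)" for x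
        by (rule smooth_on_has_derivative[OF assms])
      show "a \<in> ?S" by simp
      fix x assume x: "x \<in> ?S"
      then have xR: "x \<in> cball 0 R"
        using ab closed_segment_subset[OF _ _ convex_cball] by blast
      have "?f' x - ?f' a = (\<lambda>v. \<Sum>l\<in>UNIV. (partial l \<phi> x - partial l \<phi> a) * v $ l)"
        by (rule ext) (simp add: sum_subtractf[symmetric] left_diff_distrib)
      then have "onorm (?f' x - ?f' a) \<le> (\<Sum>l\<in>UNIV. \<bar>partial l \<phi> x - partial l \<phi> a\<bar>)"
        using onorm_coordinate_sum_le by simp
      also have "\<dots> \<le> (\<Sum>l\<in>UNIV. L l * norm (x - a))"
        by (intro sum_mono L xR ab)
      also have "\<dots> \<le> (\<Sum>l\<in>UNIV. L l) * norm (a - b)"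
        using segment_bound(1)[OF x] L(1)
        by (simp add: sum_distrib_right[symmetric] mult_left_mono sum_nonneg norm_minus_commute)
      finally show "onorm (?f' x - ?f' a) \<le> (\<Sum>l\<in>UNIV. L l) * norm (a - b)" .
    qed
    \<comment> \<open>The mean value bound runs from \<open>a\<close> to \<open>b\<close>; by
      linearity of the derivative, reversing the direction only changes the sign.\<close>
    moreover have "\<phi> b - \<phi> a - ?f' a (b - a) = - (\<phi> a - \<phi> b - ?f' a (a - b))"
      by (simp add: sum_negf[symmetric] algebra_simps sum_subtractf)
    ultimately show ?thesis
      by (simp add: norm_minus_commute[of b] power2_eq_square mult_ac)
  qed
  with that[of "\<Sum>l\<in>UNIV. L l"] L(1) show thesis by (simp add: sum_nonneg)
qed

lemma eventually_in_cball:
  fixes X :: "real \<Rightarrow> real \<Rightarrow> real^'m"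
  assumes "\<And>l. bnd 0 (\<lambda>h c. X h c $ l)"
  obtains R where "\<forall>\<^sub>F h in at_right 0. \<forall>c\<in>{0..1}. norm (X h c) \<le> R"
proof -
  have "bnd 0 (\<lambda>h c. \<Sum>l\<in>UNIV. \<bar>X h c $ l\<bar>)"
    by (intro bnd_sum bnd_abs assms)
  then obtain C where C: "\<forall>\<^sub>F h in at_right 0. 0 < h \<and> h < 1 \<and>
      continuous_on {0..1} (\<lambda>c. \<Sum>l\<in>UNIV. \<bar>X h c $ l\<bar>) \<and>
      (\<forall>c\<in>{0..1}. \<bar>\<Sum>l\<in>UNIV. \<bar>X h c $ l\<bar>\<bar> \<le> C * h ^ 0)" by (rule bndE)
  have "\<forall>\<^sub>F h in at_right 0. \<forall>c\<in>{0..1}. norm (X h c) \<le> C"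
    using C by eventually_elim (auto intro: order_trans[OF norm_le_l1_cart])
  then show thesis by (rule that)
qed

lemma eventually_continuous_vec:
  fixes X :: "real \<Rightarrow> real \<Rightarrow> real^'m"
  assumes "\<And>l. bnd k (\<lambda>h c. X h c $ l)"
  shows "\<forall>\<^sub>F h in at_right 0. continuous_on {0..1} (X h)"
proof -
  have "\<forall>\<^sub>F h in at_right 0. \<forall>l\<in>UNIV. continuous_on {0..1} (\<lambda>c. X h c $ l)"
    by (rule eventually_ball_finite) (auto intro: bnd_continuous[OF assms])
  then show ?thesis
  proof eventually_elim
    case (elim h)
    then have "continuous_on {0..1} (\<lambda>c. \<chi> l. X h c $ l)"
      by (intro continuous_on_vec_lambda) simp
    then show ?case by simp
  qed
qed

lemma bnd_compose:
  fixes X :: "real \<Rightarrow> real \<Rightarrow> real^'m" and \<phi> :: "real^'m \<Rightarrow> real"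
  assumes X: "\<And>l. bnd 0 (\<lambda>h c. X h c $ l)" and \<phi>: "continuous_on UNIV \<phi>"
  shows "bnd 0 (\<lambda>h c. \<phi> (X h c))"
proof -
  obtain R where R: "\<forall>\<^sub>F h in at_right 0. \<forall>c\<in>{0..1}. norm (X h c) \<le> R"
    using X by (rule eventually_in_cball)
  have "bounded (\<phi> ` cball 0 R)"
    using \<phi> by (intro compact_imp_bounded compact_continuous_image) (auto intro: continuous_on_subset)
  then obtain C where C: "\<And>x. x \<in> cball 0 R \<Longrightarrow> norm (\<phi> x) \<le> C"
    unfolding bounded_iff by blast
  show ?thesis
  proof (rule bndI[where C = C])
    show "\<forall>\<^sub>F h in at_right 0. continuous_on {0..1} (\<lambda>c. \<phi> (X h c))"
      using eventually_continuous_vec[OF X]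
      by eventually_elim (rule continuous_on_compose2[OF \<phi>], auto)
    show "\<forall>\<^sub>F h in at_right 0. \<forall>c\<in>{0..1}. \<bar>\<phi> (X h c)\<bar> \<le> C * h ^ 0"
      using R by eventually_elim (use C in auto)
  qed
qed

lemma norm_diff_le_sum: "norm (x - y) \<le> (\<Sum>l\<in>UNIV. \<bar>x $ l - y $ l\<bar>)" for x y :: "real^'m"
  using norm_le_l1_cart[of "x - y"] by simp

lemma dominated_smooth_diff:
  fixes X Z :: "real \<Rightarrow> real \<Rightarrow> real^'m"
  assumes X: "\<And>l. bnd 0 (\<lambda>h c. X h c $ l)" and Z: "\<And>l. bnd 0 (\<lambda>h c. Z h c $ l)"
    and \<phi>: "smooth_on UNIV \<phi>"
  shows "dominated (\<lambda>h c. \<Sum>l\<in>UNIV. \<bar>X h c $ l - Z h c $ l\<bar>) (\<lambda>h c. \<phi> (X h c) - \<phi> (Z h c))"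
    (is "dominated ?S _")
proof -
  obtain R where R: "\<forall>\<^sub>F h in at_right 0. \<forall>c\<in>{0..1}. norm (X h c) \<le> R"
    using X by (rule eventually_in_cball)
  obtain R' where R': "\<forall>\<^sub>F h in at_right 0. \<forall>c\<in>{0..1}. norm (Z h c) \<le> R'"
    using Z by (rule eventually_in_cball)
  obtain L where L: "L \<ge> 0" "\<And>a b. a \<in> cball 0 (max R R') \<Longrightarrow> b \<in> cball 0 (max R R') \<Longrightarrow>
      \<bar>\<phi> a - \<phi> b\<bar> \<le> L * norm (a - b)"
    using smooth_on_Lipschitz_cball[OF \<phi>] by blast
  have "\<forall>\<^sub>F h in at_right 0. \<forall>c\<in>{0..1}. \<bar>\<phi> (X h c) - \<phi> (Z h c)\<bar> \<le> L * ?S h c"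
    using R R'
  proof eventually_elim
    case (elim h)
    show ?case
    proof
      fix c :: real assume "c \<in> {0..1}"
      then have "\<bar>\<phi> (X h c) - \<phi> (Z h c)\<bar> \<le> L * norm (X h c - Z h c)"
        using elim by (intro L(2)) (auto simp: le_max_iff_disj)
      also have "\<dots> \<le> L * ?S h c"
        by (intro mult_left_mono L(1) norm_diff_le_sum)
      finally show "\<bar>\<phi> (X h c) - \<phi> (Z h c)\<bar> \<le> L * ?S h c" .
    qed
  qed
  with L(1) show ?thesis unfolding dominated_def by blast
qed

lemma bnd_smooth_second_order:
  fixes X Z :: "real \<Rightarrow> real \<Rightarrow> real^'m"
  assumes X: "\<And>l. bnd 0 (\<lambda>h c. X h c $ l)" and Z: "\<And>l. bnd 0 (\<lambda>h c. Z h c $ l)"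
    and \<phi>: "smooth_on UNIV \<phi>" and XZ: "\<And>l. bnd s (\<lambda>h c. X h c $ l - Z h c $ l)"
  shows "bnd (2 * s) (\<lambda>h c. \<phi> (X h c) - \<phi> (Z h c) -
    (\<Sum>l\<in>UNIV. partial l \<phi> (X h c) * (X h c $ l - Z h c $ l)))"
proof -
  obtain R where R: "\<forall>\<^sub>F h in at_right 0. \<forall>c\<in>{0..1}. norm (X h c) \<le> R"
    using X by (rule eventually_in_cball)
  obtain R' where R': "\<forall>\<^sub>F h in at_right 0. \<forall>c\<in>{0..1}. norm (Z h c) \<le> R'"
    using Z by (rule eventually_in_cball)
  obtain C where C: "C \<ge> 0" "\<And>a b. a \<in> cball 0 (max R R') \<Longrightarrow> b \<in> cball 0 (max R R') \<Longrightarrow>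
      \<bar>\<phi> a - \<phi> b - (\<Sum>l\<in>UNIV. partial l \<phi> a * (a - b) $ l)\<bar> \<le> C * (norm (a - b))\<^sup>2"
    using smooth_on_second_order_cball[OF \<phi>] by blast
  let ?S = "\<lambda>h c. \<Sum>l\<in>UNIV. \<bar>X h c $ l - Z h c $ l\<bar>"
  have "bnd s ?S" by (intro bnd_sum bnd_abs XZ)
  from bnd_mult_left[OF bnd_const bnd_mult[OF this this], of C]
  have B: "bnd (2 * s) (\<lambda>h c. C * (?S h c * ?S h c))" by (simp add: mult_2)
  \<comment> \<open>Only continuity is extracted from this bound; the order comes from
    \<open>B\<close>.\<close>
  have "bnd 0 (\<lambda>h c. \<phi> (X h c) - \<phi> (Z h c) -
    (\<Sum>l\<in>UNIV. partial l \<phi> (X h c) * (X h c $ l - Z h c $ l)))"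
    by (intro bnd_diff bnd_sum bnd_mult_left X Z
        bnd_compose[where X = X, OF X smooth_on_continuous] bnd_compose[where X = Z, OF Z smooth_on_continuous]
        smooth_on_partial \<phi>)
  note cont = bnd_continuous[OF this]
  show ?thesis
  proof (rule bnd_dominated[OF B cont])
    show "\<forall>\<^sub>F h in at_right 0. \<forall>c\<in>{0..1}. \<bar>\<phi> (X h c) - \<phi> (Z h c) -
      (\<Sum>l\<in>UNIV. partial l \<phi> (X h c) * (X h c $ l - Z h c $ l))\<bar> \<le> \<bar>C * (?S h c * ?S h c)\<bar>"
      using R R'
    proof eventually_elim
      case (elim h)
      show ?case
      proof
        fix c :: real assume "c \<in> {0..1}"
        then have "\<bar>\<phi> (X h c) - \<phi> (Z h c) - (\<Sum>l\<in>UNIV. partial l \<phi> (X h c) * (X h c - Z h c) $ l)\<bar>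
            \<le> C * (norm (X h c - Z h c))\<^sup>2"
          using elim by (intro C(2)) (auto simp: le_max_iff_disj)
        also have "\<dots> \<le> C * (?S h c)\<^sup>2"
          by (intro mult_left_mono C(1) power_mono norm_diff_le_sum norm_ge_zero)
        finally show "\<bar>\<phi> (X h c) - \<phi> (Z h c) - (\<Sum>l\<in>UNIV. partial l \<phi> (X h c) * (X h c $ l - Z h c $ l))\<bar>
            \<le> \<bar>C * (?S h c * ?S h c)\<bar>"
          using C(1) by (simp add: power2_eq_square)
      qed
    qed
  qed
qed

text \<open>The chain rule combined with the fundamental theorem. The integral form is the one to
  which \<open>expandable_integral\<close> applies.\<close>

lemma smooth_along_integral:
  fixes X :: "real \<Rightarrow> real^'m"
  assumes \<phi>: "smooth_on UNIV \<phi>" and w: "\<And>l. continuous_on {0..1} (w l)"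
    and X: "\<And>c l. c \<in> {0..1} \<Longrightarrow> X c $ l = x0 $ l + h * integral {0..c} (w l)"
    and c: "c \<in> {0..1}"
  shows "\<phi> (X c) = \<phi> x0 + h * integral {0..c} (\<lambda>t. \<Sum>l\<in>UNIV. partial l \<phi> (X t) * w l t)"
proof -
  have X0: "X 0 = x0" by (simp add: vec_eq_iff X)
  have "((\<lambda>t. h * (\<Sum>l\<in>UNIV. partial l \<phi> (X t) * w l t)) has_integral \<phi> (X c) - \<phi> (X 0)) {0..c}"
  proof (rule fundamental_theorem_of_calculus)
    fix t assume "t \<in> {0..c}"
    with c have t: "t \<in> {0..1}" by auto
    \<comment> \<open>\<open>X\<close> is known to agree with this primitive only on
      \<open>[0, 1]\<close>, so the derivative is taken within that interval and then
      transferred.\<close>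
    have "((\<lambda>c. \<Sum>l\<in>UNIV. (x0 $ l + h * integral {0..c} (w l)) *\<^sub>R axis l (1::real)) has_derivative
        (\<lambda>d. \<Sum>l\<in>UNIV. (d * (h * w l t)) *\<^sub>R axis l 1)) (at t within {0..1})"
    proof (intro has_derivative_sum has_derivative_scaleR_left)
      fix l
      have "((\<lambda>c. x0 $ l + h * integral {0..c} (w l)) has_real_derivative h * w l t) (at t within {0..1})"
        by (auto intro!: derivative_eq_intros integral_has_real_derivative w t)
      then show "((\<lambda>c. x0 $ l + h * integral {0..c} (w l)) has_derivative (\<lambda>d. d * (h * w l t))) (at t within {0..1})"
        by (simp add: has_field_derivative_def mult_commute_abs)
    qed
    then have "(X has_derivative (\<lambda>d. \<chi> l. d * (h * w l t))) (at t within {0..1})"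
      unfolding sum_scaleR_axis
      by (rule has_derivative_transform[rotated 2]) (use t in \<open>auto simp: vec_eq_iff X\<close>)
    then have "((\<lambda>t. \<phi> (X t)) has_derivative
        (\<lambda>d. \<Sum>l\<in>UNIV. partial l \<phi> (X t) * (\<chi> l. d * (h * w l t)) $ l)) (at t within {0..1})"
      by (rule has_derivative_compose[OF _ smooth_on_has_derivative[OF \<phi>]])
    then have "((\<lambda>t. \<phi> (X t)) has_vector_derivative h * (\<Sum>l\<in>UNIV. partial l \<phi> (X t) * w l t)) (at t within {0..1})"
      unfolding has_vector_derivative_def by (simp add: sum_distrib_left mult_ac)
    then show "((\<lambda>t. \<phi> (X t)) has_vector_derivative h * (\<Sum>l\<in>UNIV. partial l \<phi> (X t) * w l t)) (at t within {0..c})"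
      by (rule has_vector_derivative_within_subset) (use c in auto)
  qed (use c in simp)
  from integral_unique[OF this] show ?thesis by (simp add: X0)
qed

text \<open>Induction along the flow: \<open>\<phi> \<circ> X\<close> is an integral of first derivatives of \<open>\<phi>\<close> along \<open>X\<close>, so no
  multivariate Taylor formula is needed.\<close>

lemma expandable_compose:
  fixes X :: "real \<Rightarrow> real \<Rightarrow> real^'m"
  assumes X: "\<And>l. bnd 0 (\<lambda>h c. X h c $ l)"
    and w: "\<And>l. expandable k (w l)"
    and eq: "\<And>l. \<forall>\<^sub>F h in at_right 0. \<forall>c\<in>{0..1}. X h c $ l = x0 $ l + h * integral {0..c} (w l h)"
    and "smooth_on UNIV \<phi>" "n \<le> Suc k"
  shows "expandable n (\<lambda>h c. \<phi> (X h c))"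
  using assms(4,5)
proof (induction n arbitrary: \<phi>)
  case 0
  then show ?case using bnd_compose[OF X] smooth_on_continuous by auto
next
  case (Suc n)
  \<comment> \<open>The integrand has order \<open>n\<close> by induction for the partial
    derivatives and by \<open>w\<close>. The integral adds one, which is why \<open>n\<close> may
    reach \<open>Suc k\<close>.\<close>
  have E: "expandable (Suc n) (\<lambda>h c. \<phi> x0 + h * integral {0..c} (\<lambda>t. \<Sum>l\<in>UNIV. partial l \<phi> (X h t) * w l h t))"
    using Suc.prems
    by (intro expandable_add expandable_const expandable_integral expandable_sum expandable_mult
        Suc.IH smooth_on_partial expandable_mono[OF w]) auto
  have "\<forall>\<^sub>F h in at_right 0. \<forall>l\<in>UNIV. continuous_on {0..1} (w l h)"
    by (rule eventually_ball_finite) (auto intro: bnd_continuous[OF expandable_imp_bnd[OF w]])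
  moreover have "\<forall>\<^sub>F h in at_right 0. \<forall>l\<in>UNIV. \<forall>c\<in>{0..1}. X h c $ l = x0 $ l + h * integral {0..c} (w l h)"
    by (rule eventually_ball_finite[OF finite], rule ballI, rule eq)
  ultimately have "\<forall>\<^sub>F h in at_right 0. \<forall>c\<in>{0..1}. \<phi> (X h c) =
      \<phi> x0 + h * integral {0..c} (\<lambda>t. \<Sum>l\<in>UNIV. partial l \<phi> (X h t) * w l h t)"
    by eventually_elim (auto intro!: smooth_along_integral[OF Suc.prems(1)])
  with E show ?case by (rule expandable_cong)
qed

section \<open>Comparison of the scheme with the exact flow\<close>

lemma sum_UNIV_Plus:
  fixes f :: "'a::finite + 'b::finite \<Rightarrow> real"
  shows "(\<Sum>i\<in>UNIV. f i) = (\<Sum>l\<in>UNIV. f (Inl l)) + (\<Sum>l\<in>UNIV. f (Inr l))"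
  by (simp add: UNIV_Plus_UNIV[symmetric] sum.Plus del: UNIV_Plus_UNIV)

text \<open>\<open>(X, Y)\<close> is the scheme and \<open>(Z, W)\<close> the exact flow, both at time \<open>c * h\<close>.\<close>

context
  fixes X Y Z W :: "real \<Rightarrow> real \<Rightarrow> real^'m"
    and b :: "'m \<Rightarrow> 'm \<Rightarrow> real^'m \<Rightarrow> real" and g :: "'m \<Rightarrow> real^'m \<Rightarrow> real"
    and x0 y0 :: "real^'m" and s :: nat
    and PY F f :: "'m \<Rightarrow> real \<Rightarrow> real \<Rightarrow> real"
  defines "PY \<equiv> \<lambda>l h. proj s (\<lambda>t. Y h t $ l)"
    and "F \<equiv> \<lambda>l h t. (\<Sum>n\<in>UNIV. b l n (X h t) * PY n h t) - g l (X h t)"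
    and "f \<equiv> \<lambda>l h t. (\<Sum>n\<in>UNIV. b l n (Z h t) * W h t $ n) - g l (Z h t)"
  assumes X: "\<And>l. bnd 0 (\<lambda>h c. X h c $ l)" and Y: "\<And>l. bnd 0 (\<lambda>h c. Y h c $ l)"
    and Z: "\<And>l. bnd 0 (\<lambda>h c. Z h c $ l)" and W: "\<And>l. bnd 0 (\<lambda>h c. W h c $ l)"
    and b: "\<And>l n. smooth_on UNIV (b l n)" and g: "\<And>l. smooth_on UNIV (g l)"
    and X_eq: "\<And>l. \<forall>\<^sub>F h in at_right 0. \<forall>c\<in>{0..1}. X h c $ l = x0 $ l + h * integral {0..c} (PY l h)"
    and Y_eq: "\<And>l. \<forall>\<^sub>F h in at_right 0. \<forall>c\<in>{0..1}. Y h c $ l = y0 $ l + h * integral {0..c} (proj s (F l h))"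
    and Z_eq: "\<And>l. \<forall>\<^sub>F h in at_right 0. \<forall>c\<in>{0..1}. Z h c $ l = x0 $ l + h * integral {0..c} (\<lambda>t. W h t $ l)"
    and W_eq: "\<And>l. \<forall>\<^sub>F h in at_right 0. \<forall>c\<in>{0..1}. W h c $ l = y0 $ l + h * integral {0..c} (f l h)"
begin

text \<open>One bootstrapping round per step: order \<open>k\<close> passes from \<open>Y\<close> to
  \<open>PY\<close>, to functions of \<open>X\<close>, to \<open>F\<close> and to its projection,
  and the integral in \<open>Y_eq\<close> raises it to \<open>Suc k\<close>.\<close>

lemma expandable_scheme_velocity: "k \<le> s \<Longrightarrow> expandable k (\<lambda>h c. Y h c $ l)"
proof (induction k arbitrary: l)
  case 0
  then show ?case by (simp add: Y)
next
  case (Suc k)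
  have Yk: "expandable k (\<lambda>h c. Y h c $ l)" for l using Suc by simp
  have PYk: "expandable k (PY l)" for l
    unfolding PY_def using Suc.prems by (intro expandable_proj Yk) simp
  have Xk: "expandable k (\<lambda>h c. \<phi> (X h c))" if "smooth_on UNIV \<phi>" for \<phi>
    using expandable_compose[OF X PYk X_eq that] by simp
  have "expandable k (F l)"
    unfolding F_def by (intro expandable_diff expandable_sum expandable_mult PYk Xk b g)
  then have "expandable k (\<lambda>h. proj s (F l h))"
    using Suc.prems by (intro expandable_proj) auto
  then have "expandable (Suc k) (\<lambda>h c. y0 $ l + h * integral {0..c} (proj s (F l h)))"
    by (intro expandable_add expandable_const expandable_integral)
  then show ?case by (rule expandable_cong[OF _ Y_eq])
qed

lemma expandable_Y: "expandable s (\<lambda>h c. Y h c $ l)"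
  by (rule expandable_scheme_velocity) simp

lemma expandable_proj_Y: "expandable s (PY l)"
  unfolding PY_def by (rule expandable_proj[OF expandable_Y order_refl])

lemma expandable_smooth_X: "smooth_on UNIV \<phi> \<Longrightarrow> expandable s (\<lambda>h c. \<phi> (X h c))"
  using expandable_compose[OF X expandable_proj_Y X_eq] by simp

lemma expandable_F: "expandable s (F l)"
  unfolding F_def by (intro expandable_diff expandable_sum expandable_mult expandable_proj_Y expandable_smooth_X b g)

lemma bnd_smooth_Z: "smooth_on UNIV \<phi> \<Longrightarrow> bnd 0 (\<lambda>h c. \<phi> (Z h c))"
  by (rule bnd_compose[where X = Z, OF Z smooth_on_continuous])

lemma bnd_smooth_X: "smooth_on UNIV \<phi> \<Longrightarrow> bnd 0 (\<lambda>h c. \<phi> (X h c))"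
  by (rule bnd_compose[where X = X, OF X smooth_on_continuous])

lemma bnd_f: "bnd 0 (f l)"
  unfolding f_def by (intro bnd_diff bnd_sum bnd_mult_left bnd_smooth_Z W b g)

section \<open>The error system and its a priori order\<close>

text \<open>The sum type joins positions (\<open>Inl\<close>) and velocities (\<open>Inr\<close>)
  into one finite scalar system, the form in which the general estimates are stated.\<close>

definition err :: "'m + 'm \<Rightarrow> real \<Rightarrow> real \<Rightarrow> real" where
  "err i h c = (case i of Inl l \<Rightarrow> X h c $ l - Z h c $ l | Inr l \<Rightarrow> Y h c $ l - W h c $ l)"

definition err_rate :: "'m + 'm \<Rightarrow> real \<Rightarrow> real \<Rightarrow> real" where
  "err_rate i h c = (case i of Inl l \<Rightarrow> PY l h c - W h c $ l | Inr l \<Rightarrow> proj s (F l h) c - f l h c)"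

lemma err_simps [simp]:
  "err (Inl l) h c = X h c $ l - Z h c $ l" "err (Inr l) h c = Y h c $ l - W h c $ l"
  "err_rate (Inl l) h c = PY l h c - W h c $ l" "err_rate (Inr l) h c = proj s (F l h) c - f l h c"
  by (simp_all add: err_def err_rate_def)

lemma bnd_0_err: "bnd 0 (err i)"
  by (cases i) (auto simp: err_def[abs_def] intro: bnd_diff X Y Z W)

lemma bnd_0_err_rate: "bnd 0 (err_rate i)"
  by (cases i) (auto simp: err_rate_def[abs_def]
      intro!: bnd_diff W bnd_f expandable_imp_bnd[OF expandable_proj_Y] bnd_proj expandable_imp_bnd[OF expandable_F])

lemma err_eq: "\<forall>\<^sub>F h in at_right 0. \<forall>c\<in>{0..1}. err i h c = h * integral {0..c} (err_rate i h)"
proof (cases i)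
  case (Inl l)
  show ?thesis
    using X_eq[of l] Z_eq[of l] bnd_continuous[OF expandable_imp_bnd[OF expandable_proj_Y[of l]]] bnd_continuous[OF W[of l]]
    by eventually_elim
      (simp add: Inl err_rate_def[abs_def] integral_diff_continuous right_diff_distrib)
next
  case (Inr l)
  show ?thesis
    using Y_eq[of l] W_eq[of l] bnd_continuous[OF bnd_proj[OF expandable_imp_bnd[OF expandable_F[of l]], of s]]
      bnd_continuous[OF bnd_f[of l]]
    by eventually_elim
      (simp add: Inr err_rate_def[abs_def] integral_diff_continuous right_diff_distrib)
qed

lemma bnd_err: "bnd s (err i)"
proof -
  \<comment> \<open>The term \<open>h ^ s\<close> lets \<open>S\<close> dominate the projection
    residuals, which the error itself does not control.\<close>
  define S where "S h c = (\<Sum>j\<in>UNIV. \<bar>err j h c\<bar>) + h ^ s" for h c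
  have step_le: "\<forall>\<^sub>F h in at_right 0. \<forall>c\<in>{0..1::real}. 0 < h \<and> h ^ s \<le> S h c \<and> (\<forall>j. \<bar>err j h c\<bar> \<le> S h c)"
    using eventually_at_right_0_small[OF zero_less_one]
  proof eventually_elim
    case (elim h)
    have "\<bar>err j h c\<bar> \<le> (\<Sum>j\<in>UNIV. \<bar>err j h c\<bar>)" for j c
      by (rule member_le_sum) auto
    with elim show ?case
      by (auto simp: S_def add_increasing add_increasing2 sum_nonneg)
  qed
  have dom_err: "dominated S (err j)" for j
    unfolding dominated_def using step_le by (intro exI[of _ 1]) (auto elim: eventually_mono)
  have dom_bnd: "dominated S r" if r: "bnd s r" for r
  proof -
    from r obtain C where C: "C > 0" "\<forall>\<^sub>F h in at_right 0. 0 < h \<and> h < 1 \<and>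
      continuous_on {0..1} (r h) \<and> (\<forall>c\<in>{0..1}. \<bar>r h c\<bar> \<le> C * h ^ s)" by (rule bndE)
    have "\<forall>\<^sub>F h in at_right 0. \<forall>c\<in>{0..1}. \<bar>r h c\<bar> \<le> C * S h c"
      using C(2) step_le
    proof eventually_elim
      case (elim h)
      show ?case
      proof
        fix c :: real assume c: "c \<in> {0..1}"
        have "C * h ^ s \<le> C * S h c" using elim(2) c C(1) by (intro mult_left_mono) auto
        with elim(1) c show "\<bar>r h c\<bar> \<le> C * S h c" by (auto intro: order_trans)
      qed
    qed
    with C(1) show ?thesis unfolding dominated_def by (intro exI[of _ C]) simp
  qed
  have "dominated S (\<lambda>h c. \<Sum>l\<in>UNIV. \<bar>X h c $ l - Z h c $ l\<bar>)"
    using dom_err[of "Inl _"] by (intro dominated_sum dominated_abs) (simp add: err_def[abs_def])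
  then have dom_diff: "dominated S (\<lambda>h c. \<phi> (X h c) - \<phi> (Z h c))" if "smooth_on UNIV \<phi>" for \<phi>
    by (rule dominated_trans[OF dominated_smooth_diff[OF X Z that]])
  have "dominated S (err_rate j)" for j
  proof (cases j)
    case (Inl l)
    have "dominated S (\<lambda>h c. (PY l h c - Y h c $ l) + err (Inr l) h c)"
      unfolding PY_def by (intro dominated_add dom_bnd bnd_proj_residual expandable_Y dom_err)
    then show ?thesis by (simp add: Inl err_rate_def[abs_def])
  next
    case (Inr l)
    \<comment> \<open>Telescoping from the projected \<open>F\<close> to \<open>f\<close>: drop the
      outer projection, replace \<open>PY\<close> by \<open>Y\<close>, then \<open>Y\<close> by
      \<open>W\<close> at fixed \<open>X\<close>, and finally \<open>X\<close> by
      \<open>Z\<close>.\<close>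
    have "dominated S (\<lambda>h c. ((proj s (F l h) c - F l h c)
        + (\<Sum>n\<in>UNIV. b l n (X h c) * (PY n h c - Y h c $ n)))
        + ((\<Sum>n\<in>UNIV. b l n (X h c) * err (Inr n) h c + W h c $ n * (b l n (X h c) - b l n (Z h c)))
        - (g l (X h c) - g l (Z h c))))"
      unfolding PY_def
      by (intro dominated_add[OF dominated_add dominated_diff] dominated_sum dominated_mult dominated_add[of S] dominated_diff[OF dominated_sum]
          dom_bnd bnd_proj_residual expandable_Y expandable_F dom_err dom_diff b g bnd_smooth_X W)
    moreover have "((proj s (F l h) c - F l h c)
        + (\<Sum>n\<in>UNIV. b l n (X h c) * (PY n h c - Y h c $ n)))
        + ((\<Sum>n\<in>UNIV. b l n (X h c) * err (Inr n) h c + W h c $ n * (b l n (X h c) - b l n (Z h c)))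
        - (g l (X h c) - g l (Z h c))) = err_rate j h c" for h c
      by (simp add: Inr F_def f_def sum.distrib sum_subtractf algebra_simps)
    ultimately show ?thesis by simp
  qed
  then show ?thesis
    using bnd_of_dominated_integral_equation[of UNIV err err_rate s i] bnd_0_err err_eq
      bnd_continuous[OF bnd_0_err_rate]
    by (simp add: S_def[abs_def])
qed

section \<open>Linearisation along the scheme\<close>

text \<open>The Jacobian at \<open>(X, Y)\<close> of the field sending \<open>(x, y)\<close> to
  \<open>(y, b x y - g x)\<close>, with row \<open>i\<close> and column \<open>j\<close>. It
  contains \<open>Y\<close> rather than \<open>PY\<close>; the discrepancy is left to
  \<open>res\<close>.\<close>

definition lin :: "'m + 'm \<Rightarrow> 'm + 'm \<Rightarrow> real \<Rightarrow> real \<Rightarrow> real" where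
  "lin i j h c = (case i of
     Inl l \<Rightarrow> (case j of Inl k \<Rightarrow> 0 | Inr k \<Rightarrow> if k = l then 1 else 0)
   | Inr l \<Rightarrow> (case j of Inl k \<Rightarrow> (\<Sum>n\<in>UNIV. Y h c $ n * partial k (b l n) (X h c)) - partial k (g l) (X h c)
       | Inr k \<Rightarrow> b l k (X h c)))"

text \<open>Minus the first-order Taylor remainder of \<open>\<phi>\<close> at \<open>Z\<close>,
  expanded about \<open>X\<close>.\<close>

definition quad :: "(real^'m \<Rightarrow> real) \<Rightarrow> real \<Rightarrow> real \<Rightarrow> real" where
  "quad \<phi> h c = \<phi> (X h c) - \<phi> (Z h c) - (\<Sum>k\<in>UNIV. partial k \<phi> (X h c) * (X h c $ k - Z h c $ k))"

text \<open>Projection residuals plus quadratic terms. The product of a difference of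
  \<open>b\<close> with the velocity error is the mixed term left when \<open>b X Y - b Z W\<close>
  is expanded about the scheme in both factors.\<close>

definition res :: "'m + 'm \<Rightarrow> real \<Rightarrow> real \<Rightarrow> real" where
  "res i h c = (case i of
     Inl l \<Rightarrow> PY l h c - Y h c $ l
   | Inr l \<Rightarrow> (proj s (F l h) c - F l h c) + (\<Sum>n\<in>UNIV. b l n (X h c) * (PY n h c - Y h c $ n))
       + ((\<Sum>n\<in>UNIV. Y h c $ n * quad (b l n) h c - (b l n (X h c) - b l n (Z h c)) * err (Inr n) h c)
         - quad (g l) h c))"

lemma expandable_lin: "expandable s (lin i j)"
proof -
  have "expandable s (\<lambda>h c. (\<Sum>n\<in>UNIV. Y h c $ n * partial k (b l n) (X h c)) - partial k (g l) (X h c))" for k l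
    by (intro expandable_diff expandable_sum expandable_mult expandable_Y expandable_smooth_X smooth_on_partial b g)
  moreover have "expandable s (\<lambda>h c. if k = l then 1 else 0)" for k l :: 'm
    by simp
  ultimately show ?thesis
    by (cases i; cases j) (simp_all add: lin_def[abs_def] expandable_smooth_X b)
qed

lemma bnd_X_diff_Z: "bnd s (\<lambda>h c. X h c $ k - Z h c $ k)"
  using bnd_err[of "Inl k"] by (simp add: err_def[abs_def])

lemma bnd_quad: "smooth_on UNIV \<phi> \<Longrightarrow> bnd (2 * s) (quad \<phi>)"
  unfolding quad_def[abs_def] by (rule bnd_smooth_second_order[OF X Z _ bnd_X_diff_Z])

lemma bnd_smooth_diff:
  assumes "smooth_on UNIV \<phi>"
  shows "bnd s (\<lambda>h c. \<phi> (X h c) - \<phi> (Z h c))"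
proof -
  have "bnd s (\<lambda>h c. quad \<phi> h c + (\<Sum>k\<in>UNIV. partial k \<phi> (X h c) * (X h c $ k - Z h c $ k)))"
    by (intro bnd_add bnd_mono[OF bnd_quad] assms bnd_sum bnd_mult_left[OF bnd_smooth_X bnd_X_diff_Z] smooth_on_partial) simp
  then show ?thesis by (simp add: quad_def)
qed

text \<open>Projection residuals are hidden by orthogonality, also behind the expandable factor
  \<open>b l n (X h c)\<close>. The remaining terms are quadratic in the error, hence of order
  \<open>2 * s\<close> thanks to \<open>bnd_err\<close>.\<close>

lemma hidden_res: "hidden s (res i)"
proof (cases i)
  case (Inl l)
  then show ?thesis
    using hidden_proj_residual[OF expandable_Y[of l]] by (simp add: res_def[abs_def] PY_def)
next
  case (Inr l)
  have "bnd (2 * s) (\<lambda>h c. (b l n (X h c) - b l n (Z h c)) * err (Inr n) h c)" for n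
    unfolding mult_2 by (rule bnd_mult[OF bnd_smooth_diff[OF b] bnd_err])
  then have "bnd (2 * s) (\<lambda>h c. (\<Sum>n\<in>UNIV. Y h c $ n * quad (b l n) h c
      - (b l n (X h c) - b l n (Z h c)) * err (Inr n) h c) - quad (g l) h c)"
    by (intro bnd_diff[OF bnd_sum] bnd_diff[OF bnd_mult_left] bnd_quad b g Y)
  from hidden_bnd[OF this]
  have "hidden s (\<lambda>h c. ((proj s (F l h) c - F l h c) + (\<Sum>n\<in>UNIV. b l n (X h c) * (PY n h c - Y h c $ n)))
      + ((\<Sum>n\<in>UNIV. Y h c $ n * quad (b l n) h c - (b l n (X h c) - b l n (Z h c)) * err (Inr n) h c)
         - quad (g l) h c))"
    unfolding PY_def
    by (intro hidden_add hidden_sum hidden_mult hidden_proj_residual expandable_F expandable_Y expandable_smooth_X b)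
  then show ?thesis by (simp add: Inr res_def[abs_def])
qed

text \<open>An exact identity, free of smallness assumptions: all that the linearisation neglects is
  collected in \<open>res\<close>.\<close>

lemma err_rate_eq: "err_rate i h c = (\<Sum>j\<in>UNIV. lin i j h c * err j h c) + res i h c"
proof (cases i)
  case (Inl l)
  then show ?thesis
    by (simp add: sum_UNIV_Plus lin_def res_def if_distrib[of "\<lambda>y. y * _"] cong: if_cong)
next
  case (Inr l)
  let ?e = "\<lambda>k. X h c $ k - Z h c $ k"
  have "(\<Sum>k\<in>UNIV. (\<Sum>n\<in>UNIV. Y h c $ n * partial k (b l n) (X h c)) * ?e k) =
      (\<Sum>n\<in>UNIV. Y h c $ n * (\<Sum>k\<in>UNIV. partial k (b l n) (X h c) * ?e k))"
    unfolding sum_distrib_left sum_distrib_right mult.assoc by (rule sum.swap)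
  then have "(\<Sum>k\<in>UNIV. lin i (Inl k) h c * err (Inl k) h c) =
      (\<Sum>n\<in>UNIV. Y h c $ n * (b l n (X h c) - b l n (Z h c) - quad (b l n) h c)) -
      (g l (X h c) - g l (Z h c) - quad (g l) h c)"
    by (simp add: Inr lin_def quad_def left_diff_distrib[of _ _ "?e _"] sum_subtractf[of _ "\<lambda>k. _ k * ?e k"])
  then show ?thesis
    by (simp add: Inr sum_UNIV_Plus res_def F_def f_def)
      (simp add: lin_def sum.distrib sum_subtractf algebra_simps)
qed

lemma scheme_order:
  "bnd (2 * s + 1) (\<lambda>h c. X h 1 $ l - Z h 1 $ l)" "bnd (2 * s + 1) (\<lambda>h c. Y h 1 $ l - W h 1 $ l)"
proof -
  have "bnd (2 * s + 1) (\<lambda>h c. err i h 1)" for i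
    using err_eq
    by (intro bnd_error_end[where I = UNIV and e = err and M = lin and r = res])
      (auto simp: bnd_err expandable_lin hidden_res err_rate_eq[abs_def])
  from this[of "Inl l"] this[of "Inr l"]
  show "bnd (2 * s + 1) (\<lambda>h c. X h 1 $ l - Z h 1 $ l)" "bnd (2 * s + 1) (\<lambda>h c. Y h 1 $ l - W h 1 $ l)"
    by simp_all
qed

end

section \<open>The vector formulation\<close>

lemma integral_vec_nth:
  fixes w :: "'a::euclidean_space \<Rightarrow> 'b::euclidean_space^'m"
  assumes "w integrable_on A"
  shows "integral A w $ l = integral A (\<lambda>x. w x $ l)"
  using integral_linear[OF assms bounded_linear_vec_nth[of l]] by (simp add: o_def)

lemma gam_nth:
  assumes "continuous_on {0..1} (\<lambda>\<tau>. w (\<tau> * h))"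
  shows "gam h i w $ l = integral {0..1} (\<lambda>\<tau>. Leg i \<tau> * w (\<tau> * h) $ l)"
  unfolding gam_def
  by (subst integral_vec_nth) (auto intro!: integrable_continuous_interval continuous_intros assms)

lemma eta_nth:
  assumes "continuous_on {0..1} (\<lambda>\<tau>. w (\<tau> * h))" "smooth_on UNIV U"
  shows "eta U h i w $ l = integral {0..1} (\<lambda>\<tau>. Leg i \<tau> * partial l U (w (\<tau> * h)))"
proof -
  have "continuous_on UNIV (partial l U)" for l
    by (intro smooth_on_continuous smooth_on_partial assms)
  then have "continuous_on {0..1} (\<lambda>\<tau>. grad U (w (\<tau> * h)))"
    unfolding grad_def partial_def[symmetric]
    by (intro continuous_on_vec_lambda continuous_on_compose2[OF _ assms(1)]) auto
  then show ?thesis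
    unfolding eta_def
    by (subst integral_vec_nth)
      (auto intro!: integrable_continuous_interval continuous_intros simp: grad_def partial_def)
qed

lemma rho_nth:
  assumes "continuous_on {0..1} (\<lambda>\<tau>. w (\<tau> * h))" "smooth_on UNIV B"
  shows "rho B h i j w $ l $ n = integral {0..1} (\<lambda>\<tau>. Leg i \<tau> * (B (w (\<tau> * h)) $ l $ n * Leg j \<tau>))"
proof -
  have cont: "continuous_on {0..1} (\<lambda>\<tau>. B (w (\<tau> * h)))"
    by (rule continuous_on_compose2[OF smooth_on_continuous[OF assms(2)] assms(1)]) simp
  have "rho B h i j w $ l = integral {0..1} (\<lambda>\<tau>. ((Leg i \<tau> * Leg j \<tau>) *\<^sub>R B (w (\<tau> * h))) $ l)"
    unfolding rho_def
    by (intro integral_vec_nth integrable_continuous_interval continuous_intros cont)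
  also have "\<dots> $ n = integral {0..1} (\<lambda>\<tau>. ((Leg i \<tau> * Leg j \<tau>) *\<^sub>R B (w (\<tau> * h))) $ l $ n)"
    by (intro integral_vec_nth integrable_continuous_interval continuous_intros cont)
  finally show ?thesis by (simp add: mult_ac)
qed

lemma integral_sum_Leg:
  "(\<Sum>i<s. integral {0..c} (Leg i) * a i) = integral {0..c} (\<lambda>x. \<Sum>i<s. Leg i x * a i)"
proof -
  have "Leg i integrable_on {0..c}" for i
    using continuous_on_Leg[OF continuous_on_id, of "{0..c}" i] by (rule integrable_continuous_interval)
  then show ?thesis
    by (simp add: integral_sum integrable_on_mult_left)
qed

text \<open>Under the integral, the sum over \<open>j\<close> of \<open>rho\<close> times
  \<open>gam\<close> rebuilds the projection of the velocity from its Legendre coefficients. This is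
  why \<open>PY\<close> stands next to \<open>b\<close> in \<open>F\<close>; a stage is then the
  \<open>i\<close>-th Legendre coefficient of \<open>F\<close>.\<close>

lemma scheme_stage_nth:
  assumes "continuous_on {0..1} (\<lambda>\<tau>. x (\<tau> * h))" "continuous_on {0..1} (\<lambda>\<tau>. y (\<tau> * h))"
    and "smooth_on UNIV U" "smooth_on UNIV B"
  shows "(- eta U h i x + (\<Sum>j<s. rho B h i j x *v gam h j y)) $ l =
    integral {0..1} (\<lambda>\<tau>. Leg i \<tau> * ((\<Sum>n\<in>UNIV. B (x (\<tau> * h)) $ l $ n * proj s (\<lambda>t. y (t * h) $ n) \<tau>)
      - partial l U (x (\<tau> * h))))"
proof -
  let ?B = "\<lambda>n \<tau>. B (x (\<tau> * h)) $ l $ n" and ?G = "\<lambda>\<tau>. partial l U (x (\<tau> * h))"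
  have B: "continuous_on {0..1} (?B n)" for n
    by (intro continuous_on_component continuous_on_compose2[OF smooth_on_continuous[OF assms(4)] assms(1)]) simp
  have G: "continuous_on {0..1} ?G"
    by (rule continuous_on_compose2[OF smooth_on_continuous[OF smooth_on_partial[OF assms(3)]] assms(1)]) simp
  have "integral {0..1} (\<lambda>\<tau>. Leg i \<tau> * ((\<Sum>n\<in>UNIV. ?B n \<tau> * proj s (\<lambda>t. y (t * h) $ n) \<tau>) - ?G \<tau>)) =
      integral {0..1} (\<lambda>\<tau>. Leg i \<tau> * (\<Sum>n\<in>UNIV. ?B n \<tau> * proj s (\<lambda>t. y (t * h) $ n) \<tau>)) -
      integral {0..1} (\<lambda>\<tau>. Leg i \<tau> * ?G \<tau>)"
    unfolding right_diff_distrib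
    by (intro integral_diff integrable_Leg_mult continuous_intros B G)
  also have "integral {0..1} (\<lambda>\<tau>. Leg i \<tau> * (\<Sum>n\<in>UNIV. ?B n \<tau> * proj s (\<lambda>t. y (t * h) $ n) \<tau>)) =
      integral {0..1} (\<lambda>\<tau>. \<Sum>j<s. \<Sum>n\<in>UNIV. Leg i \<tau> * (?B n \<tau> * Leg j \<tau>) * gam h j y $ n)"
    unfolding proj_def gam_nth[OF assms(2)] sum_distrib_left
    by (intro integral_cong, subst sum.swap) (simp add: mult_ac)
  also have "\<dots> = (\<Sum>j<s. \<Sum>n\<in>UNIV. integral {0..1} (\<lambda>\<tau>. Leg i \<tau> * (?B n \<tau> * Leg j \<tau>)) * gam h j y $ n)"
    by (simp add: integral_sum integrable_sum integrable_on_mult_left integrable_Leg_mult continuous_intros B)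
  finally show ?thesis
    by (simp add: eta_nth[OF assms(1,3)] rho_nth[OF assms(1,4)] matrix_vector_mult_def)
qed

text \<open>The rectangle contains the edge \<open>h = 0\<close>; it is therefore compact, and the
  bound stays uniform as \<open>h\<close> tends to 0.\<close>

lemma bnd_of_smooth_on_rectangle:
  fixes w :: "real \<Rightarrow> real \<Rightarrow> real^'m"
  assumes "h0 > 0" "{0..1} \<times> {0..h0} \<subseteq> S" "smooth_on S (\<lambda>(c, h). w h c)"
  shows "bnd 0 (\<lambda>h c. w h c $ l)"
proof -
  have cont: "continuous_on ({0..1} \<times> {0..h0}) (\<lambda>(c, h). w h c)"
    using smooth_on_continuous[OF assms(3)] assms(2) by (rule continuous_on_subset)
  then have "bounded ((\<lambda>(c, h). w h c) ` ({0..1} \<times> {0..h0}))"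
    by (intro compact_imp_bounded compact_continuous_image compact_Times) auto
  then obtain K where K: "\<And>c h. c \<in> {0..1} \<Longrightarrow> h \<in> {0..h0} \<Longrightarrow> norm (w h c) \<le> K"
    unfolding bounded_iff by fastforce
  show ?thesis
  proof (rule bndI[where C = K])
    show "\<forall>\<^sub>F h in at_right 0. continuous_on {0..1} (\<lambda>c. w h c $ l)"
      using eventually_at_right_0_small[OF assms(1)]
    proof eventually_elim
      case (elim h)
      have "continuous_on {0..1} (\<lambda>c. case (c, h) of (c, h) \<Rightarrow> w h c)"
        by (rule continuous_on_compose2[OF cont]) (use elim in \<open>auto intro: continuous_intros\<close>)
      then show ?case by (intro continuous_on_component) simp
    qed
    show "\<forall>\<^sub>F h in at_right 0. \<forall>c\<in>{0..1}. \<bar>w h c $ l\<bar> \<le> K * h ^ 0"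
      using eventually_at_right_0_small[OF assms(1)]
      by eventually_elim (auto intro: order_trans[OF component_le_norm_cart K])
  qed
qed

lemma rescaled_time_mem: "0 < h \<Longrightarrow> h < T \<Longrightarrow> c \<in> {0..1} \<Longrightarrow> c * h \<in> {0..T}" for c h T :: real
  by (auto intro: order_trans[OF mult_left_le_one_le])

lemma bnd_of_continuous_path:
  fixes w :: "real \<Rightarrow> real^'m"
  assumes "T > 0" "continuous_on {0..T} w"
  shows "bnd 0 (\<lambda>h c. w (c * h) $ l)"
proof -
  have "bounded (w ` {0..T})"
    by (intro compact_imp_bounded compact_continuous_image assms) simp
  then obtain K where K: "\<And>t. t \<in> {0..T} \<Longrightarrow> norm (w t) \<le> K"
    unfolding bounded_iff by blast
  show ?thesis
  proof (rule bndI[where C = K])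
    show "\<forall>\<^sub>F h in at_right 0. continuous_on {0..1} (\<lambda>c. w (c * h) $ l)"
      using eventually_at_right_0_small[OF assms(1)]
    proof eventually_elim
      case (elim h)
      then show ?case
        by (intro continuous_on_component continuous_on_compose2[OF assms(2)] continuous_intros)
          (auto intro: rescaled_time_mem simp del: atLeastAtMost_iff)
    qed
    show "\<forall>\<^sub>F h in at_right 0. \<forall>c\<in>{0..1}. \<bar>w (c * h) $ l\<bar> \<le> K * h ^ 0"
      using eventually_at_right_0_small[OF assms(1)]
      by eventually_elim
        (auto intro!: order_trans[OF component_le_norm_cart K] rescaled_time_mem simp del: atLeastAtMost_iff)
  qed
qed

text \<open>Differentiation in the rescaled time \<open>c\<close> produces the factor
  \<open>h\<close>, which gives the exact flow the same shape as the scheme.\<close>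

lemma rescaled_integral_equation:
  fixes w :: "real \<Rightarrow> real^'m"
  assumes w: "\<And>t. t \<in> {0..T} \<Longrightarrow> (w has_vector_derivative w' t) (at t within {0..T})"
    and h: "0 < h" "h < T" and c: "c \<in> {0..1}"
  shows "w (c * h) $ l = w 0 $ l + h * integral {0..c} (\<lambda>t. w' (t * h) $ l)"
proof -
  have "((\<lambda>t. h * w' (t * h) $ l) has_integral w (c * h) $ l - w (0 * h) $ l) {0..c}"
  proof (rule fundamental_theorem_of_calculus)
    fix t assume "t \<in> {0..c}"
    then have t: "t \<in> {0..1}" using c by auto
    have sub: "(\<lambda>t. t * h) ` {0..c} \<subseteq> {0..T}"
      using c by (auto intro!: rescaled_time_mem[OF h] simp del: atLeastAtMost_iff) auto
    have "((\<lambda>t. t * h) has_vector_derivative h) (at t within {0..c})"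
      by (auto intro!: derivative_eq_intros)
    from vector_diff_chain_within[OF this has_vector_derivative_within_subset[OF w[OF rescaled_time_mem[OF h t]] sub]]
    have "((\<lambda>t. w (t * h)) has_vector_derivative h *\<^sub>R w' (t * h)) (at t within {0..c})"
      by (simp add: o_def)
    from bounded_linear.has_vector_derivative[OF bounded_linear_vec_nth this]
    show "((\<lambda>t. w (t * h) $ l) has_vector_derivative h * w' (t * h) $ l) (at t within {0..c})"
      by simp
  qed (use c in simp)
  from integral_unique[OF this] show ?thesis by simp
qed

lemma bigo_norm_of_bnd:
  fixes d :: "real \<Rightarrow> real^'m"
  assumes "\<And>l. bnd k (\<lambda>h c. d h $ l)"
  shows "(\<lambda>h. norm (d h)) \<in> O[at_right 0](\<lambda>h. h ^ k)"
proof -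
  have "bnd k (\<lambda>h c. \<Sum>l\<in>UNIV. \<bar>d h $ l\<bar>)"
    by (intro bnd_sum bnd_abs assms)
  then obtain C where C: "\<forall>\<^sub>F h in at_right 0. 0 < h \<and> h < 1 \<and>
      continuous_on {0..1} (\<lambda>c::real. \<Sum>l\<in>UNIV. \<bar>d h $ l\<bar>) \<and>
      (\<forall>c\<in>{0..1::real}. \<bar>\<Sum>l\<in>UNIV. \<bar>d h $ l\<bar>\<bar> \<le> C * h ^ k)"
    by (rule bndE)
  have "\<forall>\<^sub>F h in at_right 0. norm (norm (d h)) \<le> C * norm (h ^ k)"
    using C
  proof eventually_elim
    case (elim h)
    then have "\<bar>\<Sum>l\<in>UNIV. \<bar>d h $ l\<bar>\<bar> \<le> C * h ^ k" by (auto dest!: bspec[of _ _ 0])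
    with elim norm_le_l1_cart[of "d h"] show ?case by simp
  qed
  then show ?thesis by (rule bigoI)
qed

theorem theorem2:
  fixes U :: "real^'m \<Rightarrow> real" and B :: "real^'m \<Rightarrow> real^'m^'m"
    and s :: nat and q0 p0 :: "real^'m"
    and q p :: "real \<Rightarrow> real^'m" and T :: real
    and u v :: "real \<Rightarrow> real \<Rightarrow> real^'m"
  assumes U_smooth: "smooth_on UNIV U"
    and B_smooth: "smooth_on UNIV B"
    and B_skew: "\<And>x. transpose (B x) = - B x"
    and s_ge: "s \<ge> 1"
    and T_pos: "T > 0"
    and q_ode: "\<And>t. t \<in> {0..T} \<Longrightarrow> (q has_vector_derivative p t) (at t within {0..T})"
    and p_ode: "\<And>t. t \<in> {0..T} \<Longrightarrow>
        (p has_vector_derivative (B (q t) *v p t - grad U (q t))) (at t within {0..T})"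
    and q_init: "q 0 = q0" and p_init: "p 0 = p0"
    and uv_scheme: "\<forall>\<^sub>F h in at_right 0.
        vpoly_deg_le s (u h) \<and> vpoly_deg_le s (v h) \<and>
        (\<forall>c\<in>{0..1}.
           u h (c * h) = q0 + h *\<^sub>R (\<Sum>i<s. integral {0..c} (Leg i) *\<^sub>R gam h i (v h)) \<and>
           v h (c * h) = p0 + h *\<^sub>R (\<Sum>i<s. integral {0..c} (Leg i) *\<^sub>R
              (- eta U h i (u h) + (\<Sum>j<s. rho B h i j (u h) *v gam h j (v h)))))"
    and uv_smooth: "\<exists>h0 > 0. \<exists>S. {0..1} \<times> {0..h0} \<subseteq> S \<and>
        smooth_on S (\<lambda>(c, h). u h (c * h)) \<and> smooth_on S (\<lambda>(c, h). v h (c * h))"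
  shows "(\<lambda>h. norm (u h h - q h)) \<in> O[at_right 0](\<lambda>h. h ^ (2 * s + 1)) \<and>
         (\<lambda>h. norm (v h h - p h)) \<in> O[at_right 0](\<lambda>h. h ^ (2 * s + 1))"
proof -
  define X where "X h c = u h (c * h)" for h c
  define Y where "Y h c = v h (c * h)" for h c
  define Z where "Z h c = q (c * h)" for h c
  define W where "W h c = p (c * h)" for h c
  define b where "b l n x = B x $ l $ n" for l n x
  obtain h0 S where h0: "h0 > 0" "{0..1} \<times> {0..h0} \<subseteq> S"
    "smooth_on S (\<lambda>(c, h). X h c)" "smooth_on S (\<lambda>(c, h). Y h c)"
    using uv_smooth by (auto simp: X_def Y_def)
  have X: "bnd 0 (\<lambda>h c. X h c $ l)" and Y: "bnd 0 (\<lambda>h c. Y h c $ l)" for l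
    using h0 by (auto intro: bnd_of_smooth_on_rectangle)
  have "continuous_on {0..T} q"
    by (rule continuous_on_vector_derivative) (rule q_ode)
  moreover have "continuous_on {0..T} p"
    by (rule continuous_on_vector_derivative) (rule p_ode)
  ultimately have Z: "bnd 0 (\<lambda>h c. Z h c $ l)" and W: "bnd 0 (\<lambda>h c. W h c $ l)" for l
    unfolding Z_def W_def using T_pos by (auto intro: bnd_of_continuous_path)
  have b: "smooth_on UNIV (b l n)" for l n
    unfolding b_def[abs_def] by (intro smooth_on_vec_nth B_smooth)
  have G: "smooth_on UNIV (partial l U)" for l
    by (rule smooth_on_partial[OF U_smooth])
  have scheme: "\<forall>\<^sub>F h in at_right 0. \<forall>c\<in>{0..1}.
      X h c $ l = q0 $ l + h * integral {0..c} (proj s (\<lambda>t. Y h t $ l)) \<and>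
      Y h c $ l = p0 $ l + h * integral {0..c} (proj s (\<lambda>t.
        (\<Sum>n\<in>UNIV. b l n (X h t) * proj s (\<lambda>t. Y h t $ n) t) - partial l U (X h t)))" for l
    using uv_scheme eventually_continuous_vec[OF X] eventually_continuous_vec[OF Y]
  proof eventually_elim
    case (elim h)
    then have cont: "continuous_on {0..1} (\<lambda>\<tau>. u h (\<tau> * h))" "continuous_on {0..1} (\<lambda>\<tau>. v h (\<tau> * h))"
      by (simp_all add: X_def[abs_def] Y_def[abs_def])
    show ?case
    proof (intro ballI conjI)
      fix c :: real assume c: "c \<in> {0..1}"
      show "X h c $ l = q0 $ l + h * integral {0..c} (proj s (\<lambda>t. Y h t $ l))"
        using elim(1) c by (simp add: X_def Y_def gam_nth[OF cont(2)] integral_sum_Leg proj_def[abs_def])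
      \<comment> \<open>The component is taken through the outer sum only, so that each stage keeps
        the shape in which \<open>scheme_stage_nth\<close> rewrites it.\<close>
      have "v h (c * h) $ l = p0 $ l + h * (\<Sum>i<s. integral {0..c} (Leg i) *
          (- eta U h i (u h) + (\<Sum>j<s. rho B h i j (u h) *v gam h j (v h))) $ l)"
        using elim(1) c by (simp del: vector_add_component vector_uminus_component sum_component
            add: vector_add_component[of p0] sum_component[where f = "\<lambda>i. integral {0..c} (Leg i) *\<^sub>R _ i"])
      then show "Y h c $ l = p0 $ l + h * integral {0..c} (proj s (\<lambda>t.
          (\<Sum>n\<in>UNIV. b l n (X h t) * proj s (\<lambda>t. Y h t $ n) t) - partial l U (X h t)))"
        unfolding scheme_stage_nth[OF cont U_smooth B_smooth] integral_sum_Leg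
        by (simp add: X_def Y_def b_def proj_def[abs_def])
    qed
  qed
  have exact: "\<forall>\<^sub>F h in at_right 0. \<forall>c\<in>{0..1}.
      Z h c $ l = q0 $ l + h * integral {0..c} (\<lambda>t. W h t $ l) \<and>
      W h c $ l = p0 $ l + h * integral {0..c} (\<lambda>t. (\<Sum>n\<in>UNIV. b l n (Z h t) * W h t $ n) - partial l U (Z h t))" for l
    using eventually_at_right_0_small[OF T_pos]
  proof eventually_elim
    case (elim h)
    show ?case
      using rescaled_integral_equation[OF q_ode, of h _ l] rescaled_integral_equation[OF p_ode, of h _ l] elim
      by (simp add: Z_def W_def b_def q_init p_init matrix_vector_mult_def grad_def partial_def)
  qed
  note eqs = scheme[unfolded ball_conj_distrib eventually_conj_iff]
    exact[unfolded ball_conj_distrib eventually_conj_iff]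
  have "bnd (2 * s + 1) (\<lambda>h c. X h 1 $ l - Z h 1 $ l)" "bnd (2 * s + 1) (\<lambda>h c. Y h 1 $ l - W h 1 $ l)" for l
    using scheme_order[where X = X and Y = Y and Z = Z and W = W and b = b and g = "\<lambda>l. partial l U",
        OF X Y Z W b G eqs(1)[THEN conjunct1] eqs(1)[THEN conjunct2] eqs(2)[THEN conjunct1] eqs(2)[THEN conjunct2]]
    by simp_all
  then have "bnd (2 * s + 1) (\<lambda>h c. (u h h - q h) $ l)" "bnd (2 * s + 1) (\<lambda>h c. (v h h - p h) $ l)" for l
    by (simp_all add: X_def Y_def Z_def W_def)
  then show ?thesis by (intro conjI bigo_norm_of_bnd)
qed

end
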